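(* Let $p$ be a prime, let $G$ be a finite $p$-solvable group whose order is divisible by $p$, and let $P$ be a Sylow $p$-subgroup of $G$. Let $\mathfrak{U}_p(G)$ be the set of $p$-elements of $G$ and let $n_p(G)$ denote the number of Sylow $p$-subgroups of $G$. Then \[ \frac{|\mathfrak{U}_p(G)|}{|P|} \geq n_p(G)^{\frac{p-1}{p}}. \]
   Context: For a finite group $G$ and a prime $p$ dividing $|G|$, $\mathfrak{U}_p(G)=\bigcup_{P\in Syl_p(G)}P$ is the set of $p$-elements of $G$ (elements whose order is a power of $p$, including the identity). *)

theory Defs
  imports Complex_Main "HOL-Algebra.Algebra"
begin

definition sylow_subgroups :: "nat \<Rightarrow> ('a, 'b) monoid_scheme \<Rightarrow> 'a set set" where
  "sylow_subgroups p G =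
     {P. subgroup P G \<and> card P = p ^ multiplicity p (Coset.order G)}"

definition p_elements :: "nat \<Rightarrow> ('a, 'b) monoid_scheme \<Rightarrow> 'a set" where
  "p_elements p G = {x \<in> carrier G. \<exists>k. group.ord G x = p ^ k}"

(* Existence of a chain 1 = N 0 <= ... <= N n = G of normal subgroups of G each of whose factors
   N (i+1) / N i is a p-group or a p'-group.  Stated through orders, so it has this meaning for
   finite G only. *)
definition p_solvable :: "nat \<Rightarrow> ('a, 'b) monoid_scheme \<Rightarrow> bool" where
  "p_solvable p G \<longleftrightarrow>
     (\<exists>(n :: nat) N.
        N 0 = {\<one>\<^bsub>G\<^esub>} \<and> N n = carrier G \<and>
        (\<forall>i\<le>n. N i \<lhd> G) \<and>
        (\<forall>i<n. N i \<subseteq> N (Suc i) \<and>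
           ((\<exists>k. Coset.order ((G\<lparr>carrier := N (Suc i)\<rparr>) Mod N i) = p ^ k) \<or>
            coprime p (Coset.order ((G\<lparr>carrier := N (Suc i)\<rparr>) Mod N i)))))"

end

theory Submission
  imports Defs
begin

text \<open>
Write \<open>n\<close> for the number of Sylow \<open>p\<close>-subgroups and \<open>\<lambda>(x)\<close> for the number of them that contain \<open>x\<close>.
Counting pairs \<open>(x, Q)\<close> with \<open>x \<in> Q\<close>, each with weight \<open>1/\<lambda>(x)\<close>, shows that the number of
\<open>p\<close>-elements is \<open>n\<close> times the sum of \<open>1/\<lambda>(x)\<close> over a single Sylow subgroup \<open>P\<close>
(\<open>card_p_elements\<close>). By the inequality between arithmetic and geometric means
(\<open>sum_inverse_ge_of_prod_le\<close>) it is therefore enough that the product of \<open>\<lambda>(x)\<close> over \<open>x \<in> P\<close> is at most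
\<open>n\<close> to the power \<open>|P|/p\<close>. This multiplicative form is what can be proved along a normal series
(\<open>covers_bound_if_p_solvable\<close>).

For a normal subgroup \<open>K\<close> the overgroups \<open>QK\<close>, with \<open>Q\<close> a Sylow subgroup, stand for the Sylow subgroups
of \<open>G/K\<close>. Passing from \<open>K\<close> to a smaller term \<open>L\<close> of the series changes nothing if \<open>K/L\<close> is a
\<open>p\<close>-group. If \<open>K/L\<close> is a \<open>p'\<close>-group, the number of overgroups \<open>QL\<close> containing \<open>x\<close> is the
number of overgroups \<open>QK\<close> containing \<open>x\<close> times the index of \<open>C(P)\<close> in \<open>C(x)\<close>, centralizers being taken in
\<open>K/L\<close> (\<open>p'_factor_covers\<close>). So everything rests on a statement about a \<open>p\<close>-group \<open>P\<close> acting on a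
\<open>p'\<close>-group \<open>N\<close>: the product over \<open>x \<in> P\<close> of \<open>|C(x)| / |C(P)|\<close> is at most \<open>|N| / |C(P)|\<close> to the
power \<open>|P|/p\<close> (\<open>coprime_action_bound\<close>).

By Glauberman's argument fixed points of coprime actions behave multiplicatively: for each prime \<open>q\<close> there is a
\<open>P\<close>-invariant Sylow \<open>q\<close>-subgroup of \<open>N\<close>, which carries the \<open>q\<close>-part of every \<open>|C(x)|\<close>
(\<open>sylow_part_fixed_le\<close>), and the inequality is inherited by extensions (\<open>fix_bound_extension\<close>). That leaves an
abelian group \<open>V\<close> on which \<open>P\<close> acts irreducibly and nontrivially. There some \<open>w \<in> P\<close> acts centrally
with order \<open>p\<close>, the nontrivial powers of \<open>w\<close> have no fixed points, and hence for each \<open>x\<close> the \<open>p\<close>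
subgroups \<open>C(x w\<^sup>i)\<close> of \<open>V\<close> are independent, like eigenspaces: their orders multiply to at most \<open>|V|\<close>.
Multiplying over all \<open>x\<close> gives the bound (\<open>irreducible_bound\<close>).
\<close>

section \<open>Fixed points of \<open>p\<close>-groups acting on sets\<close>

text \<open>All fibres of \<open>f\<close> are left translates of \<open>D\<close>. This one count serves as
  Lagrange's theorem, the orbit-stabilizer theorem and the count of conjugates.\<close>
lemma (in group) card_eq_card_fibre_mult:
  assumes H: "subgroup H G" and fin: "finite H" and D: "D \<subseteq> H"
    and f: "\<And>a b. a \<in> H \<Longrightarrow> b \<in> H \<Longrightarrow> f a = f b \<longleftrightarrow> inv a \<otimes> b \<in> D"
  shows "card H = card D * card (f ` H)"
proof -
  interpret H: subgroup H G by (rule H)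
  have fibre: "card {a \<in> H. f a = y} = card D" if "y \<in> f ` H" for y
  proof -
    from that obtain c where c: "c \<in> H" "y = f c" by blast
    have "bij_betw (\<lambda>d. c \<otimes> d) D {a \<in> H. f a = y}"
    proof (rule bij_betwI[where g = "\<lambda>a. inv c \<otimes> a"])
      show "(\<lambda>d. c \<otimes> d) \<in> D \<rightarrow> {a \<in> H. f a = y}"
      proof
        fix d assume d: "d \<in> D"
        then have dH: "d \<in> H" using D by blast
        have "inv c \<otimes> (c \<otimes> d) = d"
          using c(1) dH by (simp add: m_assoc[symmetric])
        then have "f c = f (c \<otimes> d)"
          using f[OF c(1), of "c \<otimes> d"] c(1) dH d by simp
        then show "c \<otimes> d \<in> {a \<in> H. f a = y}" using c dH by simp
      qed
      show "(\<lambda>a. inv c \<otimes> a) \<in> {a \<in> H. f a = y} \<rightarrow> D"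
      proof
        fix a assume "a \<in> {a \<in> H. f a = y}"
        then show "inv c \<otimes> a \<in> D" using f[OF c(1), of a] c(2) by simp
      qed
      show "\<And>d. d \<in> D \<Longrightarrow> inv c \<otimes> (c \<otimes> d) = d"
        using c(1) D by (auto simp: m_assoc[symmetric] subset_iff)
      show "\<And>a. a \<in> {a \<in> H. f a = y} \<Longrightarrow> c \<otimes> (inv c \<otimes> a) = a"
        using c(1) by (auto simp: m_assoc[symmetric])
    qed
    then show ?thesis using bij_betw_same_card by fastforce
  qed
  have "card H = (\<Sum>y\<in>f ` H. card {a \<in> H. f a = y})"
    using sum.image_gen[OF fin, of "\<lambda>_. 1::nat" f] by (simp only: card_eq_sum)
  then show ?thesis using fibre by simp
qed

lemma finite_if_card_prime_power:
  fixes p :: nat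
  assumes "Factorial_Ring.prime p" "card A = p ^ k"
  shows "finite A"
  using assms by (metis card.infinite power_eq_0_iff prime_gt_0_nat neq0_conv)

lemma dvd_prime_power_cases:
  fixes n :: nat
  assumes "Factorial_Ring.prime p" "n dvd p ^ k"
  shows "n = 1 \<or> p dvd n"
  using assms by (metis divides_primepow_nat dvd_power neq0_conv power_0)

lemma prime_part_decompose:
  fixes n q :: nat
  assumes "Factorial_Ring.prime q" "n > 0"
  shows "n = q ^ multiplicity q n * (n div q ^ multiplicity q n)" "\<not> q dvd n div q ^ multiplicity q n"
  using multiplicity_dvd[of q n] multiplicity_decompose[of n q] assms not_prime_unit by auto

text \<open>Orbits have \<open>p\<close>-power length, so one that is not a fixed point can be removed from
  \<open>E\<close> without changing \<open>|E|\<close> modulo \<open>p\<close>.\<close>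
lemma (in group) p_group_fixed_point:
  assumes p: "Factorial_Ring.prime p" and A: "subgroup A G" and cA: "card A = p ^ k"
    and fin: "finite E" and ndvd: "\<not> p dvd card E"
    and closed: "\<And>a x. a \<in> A \<Longrightarrow> x \<in> E \<Longrightarrow> f a x \<in> E"
    and one: "\<And>x. x \<in> E \<Longrightarrow> f \<one> x = x"
    and mult: "\<And>a b x. a \<in> A \<Longrightarrow> b \<in> A \<Longrightarrow> x \<in> E \<Longrightarrow> f (a \<otimes> b) x = f a (f b x)"
  shows "\<exists>x\<in>E. \<forall>a\<in>A. f a x = x"
  using fin ndvd closed one mult
proof (induction "card E" arbitrary: E rule: less_induct)
  case less
  interpret A: subgroup A G by (rule A)
  have finA: "finite A" by (rule finite_if_card_prime_power[OF p cA])
  from less.prems(2) obtain x where x: "x \<in> E" by fastforce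
  define O' where "O' = (\<lambda>a. f a x) ` A"
  define S where "S = {a \<in> A. f a x = x}"
  have OX: "O' \<subseteq> E" using less.prems(3) x by (auto simp: O'_def)
  have cancel: "f (inv a) (f a y) = y" if "a \<in> A" "y \<in> E" for a y
    using less.prems(5)[of "inv a" a y] less.prems(4)[of y] that by simp
  have cancel': "f a (f (inv a) y) = y" if "a \<in> A" "y \<in> E" for a y
    using less.prems(5)[of a "inv a" y] less.prems(4)[of y] that by simp
  have "card A = card S * card O'"
    unfolding O'_def
  proof (rule card_eq_card_fibre_mult[OF A finA])
    show "S \<subseteq> A" by (auto simp: S_def)
    fix a b assume ab: "a \<in> A" "b \<in> A"
    have e: "f (inv a \<otimes> b) x = f (inv a) (f b x)" using less.prems(5) ab x by simp
    show "f a x = f b x \<longleftrightarrow> inv a \<otimes> b \<in> S"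
    proof
      assume "f a x = f b x"
      then show "inv a \<otimes> b \<in> S" using e cancel[OF ab(1) x] ab by (simp add: S_def)
    next
      assume "inv a \<otimes> b \<in> S"
      then have "f (inv a) (f b x) = x" using e by (simp add: S_def)
      then show "f a x = f b x" using cancel'[OF ab(1), of "f b x"] less.prems(3)[OF ab(2) x] by simp
    qed
  qed
  then have "card O' dvd p ^ k" using cA by (metis dvd_triv_right)
  then consider "card O' = 1" | "p dvd card O'" using dvd_prime_power_cases[OF p] by blast
  then show ?case
  proof cases
    case 1
    have "f \<one> x \<in> O'" unfolding O'_def by (rule imageI) (rule A.one_closed)
    then have "x \<in> O'" using less.prems(4)[OF x] by simp
    moreover from 1 obtain y where "O' = {y}" by (rule card_1_singletonE)
    ultimately have "O' = {x}" by simp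
    then have "\<forall>a\<in>A. f a x = x" unfolding O'_def by blast
    then show ?thesis using x by blast
  next
    case 2
    have cX: "card E = card (E - O') + card O'"
      by (metis OX add.commute card_Diff_subset card_mono finite_subset le_add_diff_inverse less.prems(1))
    have cO: "card O' > 0" using 2
      by (metis OX x O'_def A.one_closed card_gt_0_iff empty_iff finite_subset image_is_empty less.prems(1))
    have "\<exists>y\<in>E - O'. \<forall>a\<in>A. f a y = y"
    proof (rule less.hyps)
      show "card (E - O') < card E" using cX cO by simp
      show "finite (E - O')" using less.prems(1) by simp
      show "\<not> p dvd card (E - O')" using less.prems(2) 2 cX by (metis dvd_add)
      fix a y assume a: "a \<in> A" and y: "y \<in> E - O'"
      have "f a y \<notin> O'"
      proof
        assume "f a y \<in> O'"
        then obtain b where b: "b \<in> A" "f a y = f b x" unfolding O'_def by blast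
        then have "y = f (inv a) (f b x)" using cancel[OF a, of y] y by simp
        also have "\<dots> = f (inv a \<otimes> b) x" using less.prems(5) a b x by simp
        finally show False using y a b by (auto simp: O'_def)
      qed
      then show "f a y \<in> E - O'" using less.prems(3) a y by blast
    qed (use less.prems(4,5) in auto)
    then show ?thesis by blast
  qed
qed

section \<open>Conjugation and Sylow subgroups\<close>

definition conj_set :: "('a, 'b) monoid_scheme \<Rightarrow> 'a \<Rightarrow> 'a set \<Rightarrow> 'a set" where
  "conj_set G g S = (\<lambda>s. g \<otimes>\<^bsub>G\<^esub> s \<otimes>\<^bsub>G\<^esub> inv\<^bsub>G\<^esub> g) ` S"

context group begin

lemma conj_mult:
  assumes "g \<in> carrier G" "s \<in> carrier G" "t \<in> carrier G"
  shows "g \<otimes> (s \<otimes> t) \<otimes> inv g = (g \<otimes> s \<otimes> inv g) \<otimes> (g \<otimes> t \<otimes> inv g)"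
  using assms by (simp add: m_assoc inv_solve_left)

lemma conj_conj:
  assumes "g \<in> carrier G" "h \<in> carrier G" "s \<in> carrier G"
  shows "(g \<otimes> h) \<otimes> s \<otimes> inv (g \<otimes> h) = g \<otimes> (h \<otimes> s \<otimes> inv h) \<otimes> inv g"
  using assms by (simp add: m_assoc inv_mult_group)

lemma conj_inj:
  assumes "g \<in> carrier G" "s \<in> carrier G" "t \<in> carrier G"
    "g \<otimes> s \<otimes> inv g = g \<otimes> t \<otimes> inv g" shows "s = t"
  using assms by simp

lemma conj_set_one: "S \<subseteq> carrier G \<Longrightarrow> conj_set G \<one> S = S"
  by (simp add: conj_set_def subset_iff)

lemma conj_set_mult:
  assumes "g \<in> carrier G" "h \<in> carrier G" "S \<subseteq> carrier G"
  shows "conj_set G (g \<otimes> h) S = conj_set G g (conj_set G h S)"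
  using assms conj_conj unfolding conj_set_def image_image
  by (intro image_cong) auto

lemma conj_set_subset: "g \<in> carrier G \<Longrightarrow> S \<subseteq> carrier G \<Longrightarrow> conj_set G g S \<subseteq> carrier G"
  by (auto simp: conj_set_def)

lemma conj_set_inv_cancel:
  assumes "g \<in> carrier G" "S \<subseteq> carrier G"
  shows "conj_set G (inv g) (conj_set G g S) = S" "conj_set G g (conj_set G (inv g) S) = S"
  using assms conj_set_mult[of "inv g" g S] conj_set_mult[of g "inv g" S] conj_set_one by auto

lemma card_conj_set: "g \<in> carrier G \<Longrightarrow> S \<subseteq> carrier G \<Longrightarrow> card (conj_set G g S) = card S"
  unfolding conj_set_def by (rule card_image) (auto simp: inj_on_def dest: conj_inj)

lemma conj_set_closed_subgroup:
  "subgroup H G \<Longrightarrow> h \<in> H \<Longrightarrow> S \<subseteq> H \<Longrightarrow> conj_set G h S \<subseteq> H"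
  by (auto simp: conj_set_def subgroup.m_closed subgroup.m_inv_closed subset_iff)

lemma subgroup_conj_set:
  assumes g: "g \<in> carrier G" and S: "subgroup S G"
  shows "subgroup (conj_set G g S) G"
proof -
  interpret S: subgroup S G by (rule S)
  show ?thesis
  proof (rule subgroupI)
    show "conj_set G g S \<subseteq> carrier G" using g by (auto simp: conj_set_def)
    show "conj_set G g S \<noteq> {}" using S.one_closed unfolding conj_set_def by blast
    fix a assume "a \<in> conj_set G g S"
    then obtain s where s: "s \<in> S" "a = g \<otimes> s \<otimes> inv g" by (auto simp: conj_set_def)
    have "inv a = g \<otimes> inv s \<otimes> inv g" using s g by (simp add: inv_mult_group m_assoc)
    then show "inv a \<in> conj_set G g S" using s by (auto simp: conj_set_def)
    fix b assume "b \<in> conj_set G g S"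
    then obtain t where t: "t \<in> S" "b = g \<otimes> t \<otimes> inv g" by (auto simp: conj_set_def)
    have "a \<otimes> b = g \<otimes> (s \<otimes> t) \<otimes> inv g" using s t g by (simp add: conj_mult)
    then show "a \<otimes> b \<in> conj_set G g S" using s t by (auto simp: conj_set_def)
  qed
qed

lemma subgroup_stabilizer_conj:
  assumes H: "subgroup H G" and S: "S \<subseteq> carrier G"
  shows "subgroup {h \<in> H. conj_set G h S = S} G"
proof -
  interpret H: subgroup H G by (rule H)
  show ?thesis
  proof (rule subgroupI)
    show "{h \<in> H. conj_set G h S = S} \<noteq> {}" using conj_set_one[OF S] H.one_closed by blast
    fix a assume a: "a \<in> {h \<in> H. conj_set G h S = S}"
    then have "conj_set G (inv a) S = S" using conj_set_inv_cancel(1)[of a S] S by auto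
    then show "inv a \<in> {h \<in> H. conj_set G h S = S}" using a by simp
    fix b assume "b \<in> {h \<in> H. conj_set G h S = S}"
    then show "a \<otimes> b \<in> {h \<in> H. conj_set G h S = S}" using a conj_set_mult[of a b S] S by simp
  qed (use H.subset in blast)
qed

lemma conj_set_eq_iff:
  assumes "g \<in> carrier G" "h \<in> carrier G" "S \<subseteq> carrier G"
  shows "conj_set G g S = conj_set G h S \<longleftrightarrow> conj_set G (inv g \<otimes> h) S = S"
proof -
  have "conj_set G (inv g \<otimes> h) S = conj_set G (inv g) (conj_set G h S)"
    using assms by (simp add: conj_set_mult)
  then show ?thesis
    using conj_set_inv_cancel[OF assms(1,3)] conj_set_inv_cancel(2)[OF assms(1) conj_set_subset[OF assms(2,3)]]
    by force
qed

lemma inv_mult_cancel_left: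
  "x \<in> carrier G \<Longrightarrow> y \<in> carrier G \<Longrightarrow> inv x \<otimes> (x \<otimes> y) = y"
  "x \<in> carrier G \<Longrightarrow> y \<in> carrier G \<Longrightarrow> x \<otimes> (inv x \<otimes> y) = y"
  by (simp_all add: m_assoc[symmetric])

lemma rcoset_eq_iff:
  assumes "subgroup L G" "a \<in> carrier G" "b \<in> carrier G"
  shows "L #> a = L #> b \<longleftrightarrow> a \<otimes> inv b \<in> L"
proof -
  have "L #> a = L #> b \<longleftrightarrow> a \<in> L #> b"
    using repr_independence[of a L b] rcos_self[of a L] assms by auto
  then show ?thesis using subgroup.rcos_module[OF assms(1) is_group assms(3,2)] by simp
qed

text \<open>Normality turns the criterion on \<open>a \<otimes> inv b\<close> into the one on \<open>inv a
  \<otimes> b\<close> that \<open>card_eq_card_fibre_mult\<close> asks for.\<close>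
lemma normal_rcoset_eq_iff:
  assumes "L \<lhd> G" "a \<in> carrier G" "b \<in> carrier G"
  shows "L #> a = L #> b \<longleftrightarrow> inv a \<otimes> b \<in> L"
proof -
  interpret L: normal L G by (rule assms(1))
  have "a \<otimes> inv b \<in> L \<longleftrightarrow> inv a \<otimes> b \<in> L"
  proof
    assume h: "a \<otimes> inv b \<in> L"
    have "inv (inv a \<otimes> (a \<otimes> inv b) \<otimes> a) = inv a \<otimes> b"
      using assms by (simp add: m_assoc inv_mult_group inv_mult_cancel_left)
    then show "inv a \<otimes> b \<in> L" using L.inv_op_closed1[OF assms(2) h] by (metis L.m_inv_closed)
  next
    assume h: "inv a \<otimes> b \<in> L"
    have "inv (a \<otimes> (inv a \<otimes> b) \<otimes> inv a) = a \<otimes> inv b"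
      using assms by (simp add: m_assoc inv_mult_group inv_mult_cancel_left)
    then show "a \<otimes> inv b \<in> L" using L.inv_op_closed2[OF assms(2) h] by (metis L.m_inv_closed)
  qed
  then show ?thesis using rcoset_eq_iff[OF L.subgroup_axioms assms(2,3)] by simp
qed

lemma conj_set_self:
  assumes "subgroup T G" "t \<in> T" "finite T"
  shows "conj_set G t T = T"
  using assms conj_set_closed_subgroup[OF assms(1,2) subset_refl]
    card_conj_set[of t T] subgroup.subset[OF assms(1)] by (metis card_subset_eq subset_iff)

lemma card_subgroup_dvd:
  assumes "subgroup H G" "subgroup K G" "K \<subseteq> H" "finite H"
  shows "card K dvd card H"
proof -
  interpret H: group "G\<lparr>carrier := H\<rparr>" using assms(1) by (simp add: subgroup_imp_group)
  have "subgroup K (G\<lparr>carrier := H\<rparr>)" using assms by (simp add: subgroup_incl)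
  from H.lagrange[OF this] have "card H = card (rcosets\<^bsub>G\<lparr>carrier := H\<rparr>\<^esub> K) * card K"
    by (simp add: order_def)
  then show ?thesis by simp
qed

lemma card_rcosets_in:
  assumes H: "subgroup H G" and K: "subgroup K G" and sub: "K \<subseteq> H" and fin: "finite H"
  shows "card H = card K * card ((\<lambda>h. K #> h) ` H)"
proof -
  interpret H: subgroup H G by (rule H)
  interpret K: subgroup K G by (rule K)
  have "card H = card K * card ((\<lambda>h. K #> inv h) ` H)"
  proof (rule card_eq_card_fibre_mult[OF H fin sub])
    fix a b assume "a \<in> H" "b \<in> H"
    then have ab: "a \<in> carrier G" "b \<in> carrier G" by auto
    have "K #> inv a = K #> inv b \<longleftrightarrow> inv a \<in> K #> inv b"
      using repr_independence[of "inv a" K "inv b"] rcos_self[of "inv a" K] K ab by auto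
    also have "\<dots> \<longleftrightarrow> inv a \<otimes> b \<in> K"
      using K.rcos_module[OF is_group, of "inv b" "inv a"] ab by simp
    finally show "K #> inv a = K #> inv b \<longleftrightarrow> inv a \<otimes> b \<in> K" .
  qed
  also have "(\<lambda>h. K #> inv h) ` H = (\<lambda>h. K #> h) ` H"
    using H.m_inv_closed by (force simp: image_iff intro: bexI[of _ "inv _"])
  finally show ?thesis .
qed

text \<open>\<open>R\<close> acts on the cosets of \<open>S\<close> in \<open>H\<close>, whose number is prime
  to \<open>p\<close>; a fixed coset \<open>S h\<close> means that conjugation by \<open>h\<close> carries
  \<open>R\<close> into \<open>S\<close>.\<close>
lemma p_subgroup_conj_into_sylow:
  assumes p: "Factorial_Ring.prime p" and fin: "finite H" and H: "subgroup H G"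
    and S: "subgroup S G" "S \<subseteq> H" "card S = p ^ multiplicity p (card H)"
    and R: "subgroup R G" "R \<subseteq> H" "card R = p ^ k"
  shows "\<exists>h\<in>H. conj_set G h R \<subseteq> S"
proof -
  interpret H: subgroup H G by (rule H)
  interpret S: subgroup S G by (rule S)
  interpret R: subgroup R G by (rule R)
  let ?E = "(\<lambda>h. S #> h) ` H"
  have "card H > 0" using fin H.one_closed card_gt_0_iff by blast
  from prime_part_decompose[OF p this] have m: "card H = card S * m" "\<not> p dvd m"
    if "m = card H div p ^ multiplicity p (card H)" for m using S(3) that by auto
  have "card S > 0" using finite_subset[OF S(2) fin] S.one_closed card_gt_0_iff by blast
  then have nd: "\<not> p dvd card ?E" using card_rcosets_in[OF H S(1,2) fin] m[OF refl]
    by (metis mult_left_cancel neq0_conv)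
  \<comment> \<open>right translation is made a left action by inverting the group element\<close>
  have "\<exists>C\<in>?E. \<forall>r\<in>R. C #> inv r = C"
  proof (rule p_group_fixed_point[OF p R(1,3) _ nd])
    show "finite ?E" using fin by simp
    fix a C assume a: "a \<in> R" and "C \<in> ?E"
    then obtain h where h: "h \<in> H" "C = S #> h" by blast
    have "C #> inv a = S #> (h \<otimes> inv a)" using h a by (simp add: coset_mult_assoc S.subset)
    moreover have "h \<otimes> inv a \<in> H" using h a R(2) by blast
    ultimately show "C #> inv a \<in> ?E" by blast
  next
    fix C assume "C \<in> ?E"
    then obtain h where h: "h \<in> H" "C = S #> h" by blast
    then have C: "C \<subseteq> carrier G" by (simp add: r_coset_subset_G S.subset)
    then show "C #> inv \<one> = C" by simp
    fix a b assume "a \<in> R" "b \<in> R"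
    then show "C #> inv (a \<otimes> b) = C #> inv b #> inv a"
      using C by (simp add: coset_mult_assoc inv_mult_group)
  qed
  then obtain h where h: "h \<in> H" "\<forall>r\<in>R. S #> h #> inv r = S #> h" by blast
  have "h \<otimes> r \<otimes> inv h \<in> S" if r: "r \<in> R" for r
  proof -
    have "S #> (h \<otimes> r) = S #> h #> inv (inv r)" using h(1) r by (simp add: coset_mult_assoc S.subset)
    also have "\<dots> = S #> h" using h(2) r by blast
    finally have "h \<otimes> r \<in> S #> h" using rcos_self[of "h \<otimes> r" S] h(1) r S(1) by simp
    then show ?thesis using S.rcos_module_imp[OF is_group, of h "h \<otimes> r"] h(1) r by simp
  qed
  then show ?thesis using h(1) by (auto simp: conj_set_def)
qed

lemma sylow_exists_in:
  assumes p: "Factorial_Ring.prime p" and fin: "finite H" and H: "subgroup H G"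
  shows "\<exists>S. subgroup S G \<and> S \<subseteq> H \<and> card S = p ^ multiplicity p (card H)"
proof -
  obtain m where "card H = p ^ multiplicity p (card H) * m" using multiplicity_dvd by blast
  then have "\<exists>S. subgroup S (G\<lparr>carrier := H\<rparr>) \<and> card S = p ^ multiplicity p (card H)"
    using sylow_thm[OF p, of "G\<lparr>carrier := H\<rparr>"] H fin by (simp add: order_def subgroup_imp_group)
  then show ?thesis using incl_subgroup[OF H] subgroup.subset by fastforce
qed

end

context group begin

text \<open>\<open>M\<close> acts on its cosets in \<open>T\<close>. Their number is divisible by
  \<open>q\<close> and \<open>M\<close> itself is a fixed one, so there is another fixed coset, and it
  consists of elements normalizing \<open>M\<close>.\<close>
lemma normalizer_grows:
  assumes q: "Factorial_Ring.prime q" and T: "subgroup T G" "card T = q ^ b"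
    and M: "subgroup M G" "M \<subset> T"
  shows "\<exists>g\<in>T - M. conj_set G g M = M"
proof -
  interpret T: subgroup T G by (rule T)
  interpret M: subgroup M G by (rule M)
  have finT: "finite T" by (rule finite_if_card_prime_power[OF q T(2)])
  have finM: "finite M" using finT M(2) finite_subset by blast
  let ?E = "(\<lambda>h. M #> h) ` T"
  have cE: "card T = card M * card ?E" using card_rcosets_in[OF T(1) M(1) _ finT] M(2) by blast
  have "card M < card T" using psubset_card_mono[OF finT M(2)] .
  then have "card ?E \<noteq> 1" using cE by auto
  moreover have "card ?E dvd q ^ b" using cE T(2) by (metis dvd_triv_right)
  ultimately have qE: "q dvd card ?E" using dvd_prime_power_cases[OF q] by blast
  have ME: "M \<in> ?E" using coset_mult_one[OF M.subset] T.one_closed by (metis image_eqI)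
  have "card ?E > 0" using ME finT by (auto simp: card_gt_0_iff)
  then have nd: "\<not> q dvd card (?E - {M})" using qE ME finT q
    by (simp add: card_Diff_singleton) (metis One_nat_def Suc_pred dvd_1_iff_1 dvd_add_right_iff not_prime_1 plus_1_eq_Suc add.commute)
  have cosM: "C \<subseteq> carrier G" if "C \<in> ?E" for C
    using that T.subset r_coset_subset_G[OF M.subset] by blast
  have "\<exists>C\<in>?E - {M}. \<forall>m\<in>M. C #> inv m = C"
  proof (rule p_group_fixed_point[OF q M(1) _ _ nd])
    have "card M dvd q ^ b" using card_subgroup_dvd[OF T(1) M(1) _ finT] M(2) T(2) by auto
    then show "card M = q ^ multiplicity q (card M)"
      using q by (metis divides_primepow_nat multiplicity_same_power prime_gt_1_nat not_prime_unit prime_def not_prime_0)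
    show "finite (?E - {M})" using finT by simp
    fix a C assume a: "a \<in> M" and C: "C \<in> ?E - {M}"
    then obtain h where h: "h \<in> T" "C = M #> h" by blast
    have aT: "a \<in> T" using a M(2) by blast
    have e: "C #> inv a = M #> (h \<otimes> inv a)" using h a by (simp add: coset_mult_assoc M.subset)
    have "h \<otimes> inv a \<in> T" using h aT by blast
    moreover have "C #> inv a \<noteq> M"
    proof
      assume "C #> inv a = M"
      then have "C #> inv a #> a = M #> a" by simp
      then have "C = M" using C cosM[of C] a coset_join2[of a M] M(1) by (simp add: coset_mult_assoc)
      then show False using C by blast
    qed
    ultimately show "C #> inv a \<in> ?E - {M}" using e by blast
  next
    fix C assume "C \<in> ?E - {M}"
    then have C: "C \<subseteq> carrier G" using cosM by blast
    then show "C #> inv \<one> = C" by simp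
    fix a b assume "a \<in> M" "b \<in> M"
    then show "C #> inv (a \<otimes> b) = C #> inv b #> inv a"
      using C by (simp add: coset_mult_assoc inv_mult_group)
  qed
  then obtain h where h: "h \<in> T" "M #> h \<noteq> M" "\<forall>r\<in>M. M #> h #> inv r = M #> h" by blast
  have "h \<otimes> r \<otimes> inv h \<in> M" if r: "r \<in> M" for r
  proof -
    have "M #> (h \<otimes> r) = M #> h #> inv (inv r)" using h(1) r by (simp add: coset_mult_assoc M.subset)
    also have "\<dots> = M #> h" using h(3) r by blast
    finally have "h \<otimes> r \<in> M #> h" using rcos_self[of "h \<otimes> r" M] h(1) r M(1) by simp
    then show ?thesis using M.rcos_module_imp[OF is_group, of h "h \<otimes> r"] h(1) r by simp
  qed
  then have "conj_set G h M \<subseteq> M" by (auto simp: conj_set_def)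
  then have "conj_set G h M = M" using card_conj_set[of h M] h(1) M.subset finM by (simp add: card_subset_eq)
  moreover have "h \<notin> M" using h(1,2) coset_join2[of h M] M(1) by auto
  ultimately show ?thesis using h(1) by blast
qed

end

section \<open>Actions by automorphisms and invariant Sylow subgroups\<close>

definition fixed_by :: "('c \<Rightarrow> 'a \<Rightarrow> 'a) \<Rightarrow> 'c set \<Rightarrow> 'a set \<Rightarrow> 'a set" where
  "fixed_by \<phi> A H = {h \<in> H. \<forall>x\<in>A. \<phi> x h = h}"

definition stable :: "('c \<Rightarrow> 'a \<Rightarrow> 'a) \<Rightarrow> 'c set \<Rightarrow> 'a set \<Rightarrow> bool" where
  "stable \<phi> A H \<longleftrightarrow> (\<forall>x\<in>A. \<forall>h\<in>H. \<phi> x h \<in> H)"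

locale aut_action = group G + P: group P
  for G :: "('a, 'b) monoid_scheme" (structure) and P :: "('c, 'd) monoid_scheme" +
  fixes \<phi> :: "'c \<Rightarrow> 'a \<Rightarrow> 'a"
  assumes act_closed: "x \<in> carrier P \<Longrightarrow> g \<in> carrier G \<Longrightarrow> \<phi> x g \<in> carrier G"
    and act_hom: "x \<in> carrier P \<Longrightarrow> g \<in> carrier G \<Longrightarrow> h \<in> carrier G \<Longrightarrow> \<phi> x (g \<otimes> h) = \<phi> x g \<otimes> \<phi> x h"
    and act_mult: "x \<in> carrier P \<Longrightarrow> y \<in> carrier P \<Longrightarrow> g \<in> carrier G \<Longrightarrow> \<phi> (x \<otimes>\<^bsub>P\<^esub> y) g = \<phi> x (\<phi> y g)"
    and act_one: "g \<in> carrier G \<Longrightarrow> \<phi> \<one>\<^bsub>P\<^esub> g = g"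
begin

lemma act_group_hom: "x \<in> carrier P \<Longrightarrow> group_hom G G (\<phi> x)"
  by unfold_locales (auto simp: hom_def act_closed act_hom)

lemma act_G_one: "x \<in> carrier P \<Longrightarrow> \<phi> x \<one> = \<one>"
  using group_hom.hom_one[OF act_group_hom] .

lemma act_G_inv: "x \<in> carrier P \<Longrightarrow> g \<in> carrier G \<Longrightarrow> \<phi> x (inv g) = inv (\<phi> x g)"
  using group_hom.hom_inv[OF act_group_hom] .

lemma act_inv_cancel:
  assumes "x \<in> carrier P" "g \<in> carrier G"
  shows "\<phi> (inv\<^bsub>P\<^esub> x) (\<phi> x g) = g" "\<phi> x (\<phi> (inv\<^bsub>P\<^esub> x) g) = g"
  using assms act_mult[of "inv\<^bsub>P\<^esub> x" x g] act_mult[of x "inv\<^bsub>P\<^esub> x" g] by (simp_all add: act_one)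

lemma act_inj: "x \<in> carrier P \<Longrightarrow> inj_on (\<phi> x) (carrier G)"
  by (metis act_inv_cancel(1) inj_onI)

lemma stable_image_eq:
  assumes A: "subgroup A P" and H: "H \<subseteq> carrier G" and st: "stable \<phi> A H" and x: "x \<in> A"
  shows "\<phi> x ` H = H"
proof
  show "\<phi> x ` H \<subseteq> H" using st x by (auto simp: stable_def)
  show "H \<subseteq> \<phi> x ` H"
  proof
    fix h assume h: "h \<in> H"
    have "\<phi> (inv\<^bsub>P\<^esub> x) h \<in> H" using st h subgroup.m_inv_closed[OF A x] by (auto simp: stable_def)
    moreover have "h = \<phi> x (\<phi> (inv\<^bsub>P\<^esub> x) h)" using act_inv_cancel(2)[of x h] h H subgroup.mem_carrier[OF A x] by auto
    ultimately show "h \<in> \<phi> x ` H" by blast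
  qed
qed

lemma subgroup_act_image: "x \<in> carrier P \<Longrightarrow> subgroup S G \<Longrightarrow> subgroup (\<phi> x ` S) G"
  using group_hom.subgroup_img_is_subgroup[OF act_group_hom] .

lemma card_act_image: "x \<in> carrier P \<Longrightarrow> S \<subseteq> carrier G \<Longrightarrow> card (\<phi> x ` S) = card S"
  using act_inj card_image inj_on_subset by metis

lemma act_conj_set:
  assumes "x \<in> carrier P" "g \<in> carrier G" "S \<subseteq> carrier G"
  shows "\<phi> x ` conj_set G g S = conj_set G (\<phi> x g) (\<phi> x ` S)"
  using assms unfolding conj_set_def image_image
  by (intro image_cong) (auto simp: act_hom act_G_inv subset_iff)

lemma subgroup_fixed_by:
  assumes A: "A \<subseteq> carrier P" and H: "subgroup H G"
  shows "subgroup (fixed_by \<phi> A H) G"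
proof -
  interpret H: subgroup H G by (rule H)
  show ?thesis
    by (rule subgroupI)
       (use A in \<open>auto simp: fixed_by_def act_G_one act_G_inv act_hom subset_iff intro!: exI[of _ \<one>]\<close>)
qed

text \<open>Lets results about \<open>p\<close>-subgroups of the acting group be applied to the fixed points
  of a single element.\<close>
lemma fixed_by_generate:
  assumes A: "A \<subseteq> carrier P" and H: "H \<subseteq> carrier G"
  shows "fixed_by \<phi> (generate P A) H = fixed_by \<phi> A H"
proof
  show "fixed_by \<phi> (generate P A) H \<subseteq> fixed_by \<phi> A H"
    by (auto simp: fixed_by_def intro: generate.incl)
  show "fixed_by \<phi> A H \<subseteq> fixed_by \<phi> (generate P A) H"
  proof
    fix h assume h: "h \<in> fixed_by \<phi> A H"
    then have hG: "h \<in> carrier G" using H by (auto simp: fixed_by_def)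
    have "\<phi> x h = h" if "x \<in> generate P A" for x
      using that
    proof (induction rule: generate.induct)
      case one then show ?case using act_one hG by simp
    next
      case (incl x) then show ?case using h by (simp add: fixed_by_def)
    next
      case (inv x)
      then have "\<phi> x h = h" using h by (simp add: fixed_by_def)
      then show ?case using act_inv_cancel(1)[of x h] hG inv A by auto
    next
      case (eng x y)
      then show ?case using act_mult[of x y h] hG P.generate_incl[OF A] by auto
    qed
    then show "h \<in> fixed_by \<phi> (generate P A) H" using h by (simp add: fixed_by_def)
  qed
qed

text \<open>An invariant coset of \<open>M\<close> has \<open>|M|\<close> elements, a number prime to
  \<open>p\<close>.\<close>
lemma fixed_point_in_coset:
  assumes p: "Factorial_Ring.prime p" and A: "subgroup A P" "card A = p ^ k"
    and M: "subgroup M G" "stable \<phi> A M" "finite M" "\<not> p dvd card M"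
    and g: "g \<in> carrier G" "\<And>x. x \<in> A \<Longrightarrow> \<phi> x g \<in> M #> g"
  shows "\<exists>h\<in>M #> g. \<forall>x\<in>A. \<phi> x h = h"
proof (rule P.p_group_fixed_point[OF p A])
  interpret M: subgroup M G by (rule M)
  have "card (M #> g) = card M"
    using card_cosets_equal[OF rcosetsI[OF M.subset g(1)] M.subset] bij_betw_same_card by fastforce
  then show "\<not> p dvd card (M #> g)" using M(4) by simp
  show "finite (M #> g)" using M(3) by (simp add: r_coset_def)
  fix y assume y: "y \<in> M #> g"
  then obtain m where m: "m \<in> M" "y = m \<otimes> g" by (auto simp: r_coset_def)
  have yG: "y \<in> carrier G" using m g by simp
  show "\<phi> \<one>\<^bsub>P\<^esub> y = y" using act_one yG by simp
  { fix x assume x: "x \<in> A"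
    then have xP: "x \<in> carrier P" using A subgroup.mem_carrier by metis
    obtain m' where m': "m' \<in> M" "\<phi> x g = m' \<otimes> g" using g(2)[OF x] by (auto simp: r_coset_def)
    have "\<phi> x y = (\<phi> x m \<otimes> m') \<otimes> g" using m m' g xP by (simp add: act_hom m_assoc act_closed)
    moreover have "\<phi> x m \<in> M" using M(2) x m by (auto simp: stable_def)
    ultimately show "\<phi> x y \<in> M #> g" using m' by (auto simp: r_coset_def)
    fix z assume "z \<in> A"
    then show "\<phi> (x \<otimes>\<^bsub>P\<^esub> z) y = \<phi> x (\<phi> z y)" using xP act_mult yG A subgroup.mem_carrier by metis }
qed

text \<open>The number of Sylow \<open>q\<close>-subgroups of \<open>H\<close> divides \<open>|H|\<close>, so
  the \<open>p\<close>-group \<open>A\<close> permuting them fixes one.\<close>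
lemma stable_sylow_exists:
  assumes p: "Factorial_Ring.prime p" and A: "subgroup A P" "card A = p ^ k"
    and H: "subgroup H G" "stable \<phi> A H" "finite H" "\<not> p dvd card H"
    and q: "Factorial_Ring.prime q"
  shows "\<exists>S. subgroup S G \<and> S \<subseteq> H \<and> stable \<phi> A S \<and> card S = q ^ multiplicity q (card H)"
proof -
  interpret H: subgroup H G by (rule H)
  let ?n = "q ^ multiplicity q (card H)"
  obtain S0 where S0: "subgroup S0 G" "S0 \<subseteq> H" "card S0 = ?n"
    using sylow_exists_in[OF q H(3,1)] by blast
  have S0c: "S0 \<subseteq> carrier G" using S0(2) by auto
  let ?E = "{S. subgroup S G \<and> S \<subseteq> H \<and> card S = ?n}"
  have cH0: "card H > 0" using H(3) H.one_closed card_gt_0_iff by blast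
  have E: "?E = (\<lambda>h. conj_set G h S0) ` H"
  proof
    show "(\<lambda>h. conj_set G h S0) ` H \<subseteq> ?E"
      using S0 S0c subgroup_conj_set card_conj_set conj_set_closed_subgroup[OF H(1) _ S0(2)]
      by (simp add: image_subset_iff)
    show "?E \<subseteq> (\<lambda>h. conj_set G h S0) ` H"
    proof
      fix S assume S: "S \<in> ?E"
      then have Sc: "S \<subseteq> carrier G" by auto
      obtain h where h: "h \<in> H" "conj_set G h S0 \<subseteq> S"
        using p_subgroup_conj_into_sylow[OF q H(3,1) _ _ _ S0] S by blast
      have "finite S" using S H(3) finite_subset by auto
      then have "conj_set G h S0 = S"
        using h S S0 card_conj_set[of h S0] S0c by (simp add: card_subset_eq)
      then show "S \<in> (\<lambda>h. conj_set G h S0) ` H" using h(1) by blast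
    qed
  qed
  have "card H = card {h \<in> H. conj_set G h S0 = S0} * card ?E"
    unfolding E
  proof (rule card_eq_card_fibre_mult[OF H(1,3)])
    fix a b assume "a \<in> H" "b \<in> H"
    then show "conj_set G a S0 = conj_set G b S0 \<longleftrightarrow> inv a \<otimes> b \<in> {h \<in> H. conj_set G h S0 = S0}"
      using conj_set_eq_iff[of a b S0] S0c by simp
  qed blast
  from dvdI[OF this[unfolded mult.commute[of _ "card ?E"]]]
  have nd: "\<not> p dvd card ?E" using H(4) dvd_trans by blast
  have finE: "finite ?E" using H(3) E by simp
  have AP: "x \<in> carrier P" if "x \<in> A" for x using that A subgroup.mem_carrier by metis
  have "\<exists>S\<in>?E. \<forall>x\<in>A. \<phi> x ` S = S"
  proof (rule P.p_group_fixed_point[OF p A finE nd])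
    fix x S assume x: "x \<in> A" and S: "S \<in> ?E"
    have "\<phi> x ` S \<subseteq> H" using x S H(2) by (auto simp: stable_def)
    moreover have "S \<subseteq> carrier G" using S by auto
    ultimately show "\<phi> x ` S \<in> ?E"
      using x S AP subgroup_act_image card_act_image by simp
  next
    fix S assume S: "S \<in> ?E"
    then have Sc: "S \<subseteq> carrier G" by auto
    then show "\<phi> \<one>\<^bsub>P\<^esub> ` S = S" using act_one by (simp add: subset_iff)
    fix x y assume "x \<in> A" "y \<in> A"
    then show "\<phi> (x \<otimes>\<^bsub>P\<^esub> y) ` S = \<phi> x ` \<phi> y ` S"
      using Sc AP act_mult unfolding image_image by (intro image_cong) auto
  qed
  then obtain S where "S \<in> ?E" "\<And>x. x \<in> A \<Longrightarrow> \<phi> x ` S = S" by blast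
  moreover from this(2) have "stable \<phi> A S" unfolding stable_def by blast
  ultimately show ?thesis by blast
qed

lemma stable_normalizer:
  assumes A: "subgroup A P" and H: "subgroup H G" "stable \<phi> A H"
    and M: "M \<subseteq> carrier G" "stable \<phi> A M"
  shows "stable \<phi> A {h \<in> H. conj_set G h M = M}"
  unfolding stable_def
proof (intro ballI)
  fix x h assume x: "x \<in> A" and h: "h \<in> {h \<in> H. conj_set G h M = M}"
  have xP: "x \<in> carrier P" using x A subgroup.mem_carrier by metis
  have hG: "h \<in> carrier G" using h H(1) subgroup.mem_carrier by fastforce
  have "conj_set G (\<phi> x h) M = \<phi> x ` conj_set G h M"
    using act_conj_set[OF xP hG M(1)] stable_image_eq[OF A M x] by simp
  also have "\<dots> = M" using h stable_image_eq[OF A M x] by simp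
  finally show "\<phi> x h \<in> {h \<in> H. conj_set G h M = M}" using H(2) x h by (auto simp: stable_def)
qed

text \<open>The elements conjugating \<open>T\<close> to \<open>S\<close> form an invariant coset of the
  normalizer of \<open>S\<close>; a fixed point in it is the required element (Glauberman's lemma).\<close>
lemma stable_sylow_conj:
  assumes p: "Factorial_Ring.prime p" and A: "subgroup A P" "card A = p ^ k"
    and H: "subgroup H G" "stable \<phi> A H" "finite H" "\<not> p dvd card H"
    and q: "Factorial_Ring.prime q"
    and S: "subgroup S G" "S \<subseteq> H" "stable \<phi> A S" "card S = q ^ multiplicity q (card H)"
    and T: "subgroup T G" "T \<subseteq> H" "stable \<phi> A T" "card T = q ^ multiplicity q (card H)"
  shows "\<exists>c\<in>fixed_by \<phi> A H. conj_set G c T = S"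
proof -
  interpret H: subgroup H G by (rule H)
  have Sc: "S \<subseteq> carrier G" and Tc: "T \<subseteq> carrier G" using S T by auto
  let ?n = "q ^ multiplicity q (card H)"
  have cH0: "card H > 0" using H(3) H.one_closed card_gt_0_iff by blast
  obtain h where h: "h \<in> H" "conj_set G h T \<subseteq> S"
    using p_subgroup_conj_into_sylow[OF q H(3,1) S(1,2,4) T(1,2,4)] by blast
  have hc: "conj_set G h T = S"
    using h S T card_conj_set[of h T] Tc finite_subset[OF S(2) H(3)] by (simp add: card_subset_eq)
  let ?M = "{h \<in> H. conj_set G h S = S}"
  have M: "subgroup ?M G" by (rule subgroup_stabilizer_conj[OF H(1) Sc])
  have "\<exists>c\<in>?M #> h. \<forall>x\<in>A. \<phi> x c = c"
  proof (rule fixed_point_in_coset[OF p A M])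
    show "stable \<phi> A ?M" by (rule stable_normalizer[OF A(1) H(1,2) Sc S(3)])
    show "finite ?M" using H(3) by simp
    have "card ?M dvd card H" by (rule card_subgroup_dvd[OF H(1) M _ H(3)]) auto
    then show "\<not> p dvd card ?M" using H(4) dvd_trans by blast
    show hG: "h \<in> carrier G" using h by simp
    fix x assume x: "x \<in> A"
    have xP: "x \<in> carrier P" using x A subgroup.mem_carrier by metis
    have xh: "\<phi> x h \<in> H" using H(2) x h by (auto simp: stable_def)
    have "conj_set G (\<phi> x h) T = S"
      using act_conj_set[OF xP hG Tc] stable_image_eq[OF A(1) Tc T(3) x]
        stable_image_eq[OF A(1) Sc S(3) x] hc by simp
    then have "conj_set G (\<phi> x h \<otimes> inv h) S = S"
      using conj_set_mult[of "\<phi> x h" "inv h" S] conj_set_inv_cancel(1)[of h T] hc xh hG Tc Sc by simp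
    then have "\<phi> x h \<otimes> inv h \<in> ?M" using xh h by simp
    then show "\<phi> x h \<in> ?M #> h" using subgroup.rcos_module_rev[OF M is_group hG] xh by simp
  qed
  then obtain c where c: "c \<in> ?M #> h" "\<forall>x\<in>A. \<phi> x c = c" by blast
  then obtain m where m: "m \<in> ?M" "c = m \<otimes> h" by (auto simp: r_coset_def)
  have "conj_set G c T = S" using m h hc Tc by (simp add: conj_set_mult)
  moreover have "c \<in> H" using m h by simp
  ultimately show ?thesis using c by (auto simp: fixed_by_def)
qed

text \<open>If \<open>M\<close> is not yet a Sylow subgroup, then it is not one of its own normalizer either,
  because normalizers grow in a Sylow subgroup \<open>T\<close> containing \<open>M\<close>. An invariant
  Sylow \<open>q\<close>-subgroup of that normalizer contains the normal subgroup \<open>M\<close> and is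
  strictly larger.\<close>
lemma stable_sylow_above:
  assumes p: "Factorial_Ring.prime p" and A: "subgroup A P" "card A = p ^ k"
    and H: "subgroup H G" "stable \<phi> A H" "finite H" "\<not> p dvd card H"
    and q: "Factorial_Ring.prime q"
    and M: "subgroup M G" "M \<subseteq> H" "stable \<phi> A M" "card M = q ^ j"
  shows "\<exists>S. subgroup S G \<and> M \<subseteq> S \<and> S \<subseteq> H \<and> stable \<phi> A S \<and> card S = q ^ multiplicity q (card H)"
  using M
proof (induction "card H - card M" arbitrary: M j rule: less_induct)
  case less
  note M = less.prems
  interpret H: subgroup H G by (rule H)
  interpret M: subgroup M G by (rule M)
  let ?n = "q ^ multiplicity q (card H)"
  have cH0: "card H > 0" using H(3) H.one_closed card_gt_0_iff by blast
  show ?case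
  proof (cases "card M = ?n")
    case True
    then show ?thesis using M by blast
  next
    case False
    obtain T0 where T0: "subgroup T0 G" "T0 \<subseteq> H" "card T0 = ?n"
      using sylow_exists_in[OF q H(3,1)] by blast
    obtain h where h: "h \<in> H" "conj_set G h M \<subseteq> T0"
      using p_subgroup_conj_into_sylow[OF q H(3,1) T0 M(1,2,4)] by blast
    define T where "T = conj_set G (inv h) T0"
    have T0c: "T0 \<subseteq> carrier G" using T0(2) by auto
    have T: "subgroup T G" "T \<subseteq> H" "card T = ?n"
      using T0 T0c h(1) unfolding T_def
      by (simp_all add: subgroup_conj_set card_conj_set conj_set_closed_subgroup[OF H(1)])
    have "conj_set G (inv h) (conj_set G h M) \<subseteq> T"
      using h(2) unfolding T_def by (auto simp: conj_set_def)
    then have "M \<subseteq> T" using conj_set_inv_cancel(1)[of h M] h(1) M.subset by simp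
    then have MT: "M \<subset> T" using False T(3) by blast
    obtain g where g: "g \<in> T" "g \<notin> M" "conj_set G g M = M"
      using normalizer_grows[OF q T(1,3) M(1) MT] by blast
    let ?N = "{h \<in> H. conj_set G h M = M}"
    have N: "subgroup ?N G" by (rule subgroup_stabilizer_conj[OF H(1) M.subset])
    have finN: "finite ?N" using H(3) by simp
    have cN0: "card ?N > 0" using finN subgroup.one_closed[OF N] card_gt_0_iff by blast
    have "card ?N dvd card H" by (rule card_subgroup_dvd[OF H(1) N _ H(3)]) auto
    then have pN: "\<not> p dvd card ?N" using H(4) dvd_trans by blast
    obtain M' where M': "subgroup M' G" "M' \<subseteq> ?N" "stable \<phi> A M'" "card M' = q ^ multiplicity q (card ?N)"
      using stable_sylow_exists[OF p A N stable_normalizer[OF A(1) H(1,2) M.subset M(3)] finN pN q] by blast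
    have MN: "M \<subseteq> ?N"
    proof
      fix m assume m: "m \<in> M"
      have "conj_set G m M = M" by (rule conj_set_self[OF M(1) m finite_subset[OF M(2) H(3)]])
      then show "m \<in> ?N" using m M(2) by blast
    qed
    obtain n where n: "n \<in> ?N" "conj_set G n M \<subseteq> M'"
      using p_subgroup_conj_into_sylow[OF q finN N M'(1,2,4) M(1) MN M(4)] by blast
    then have MM': "M \<subseteq> M'" by simp
    have W: "subgroup (T \<inter> ?N) G" by (rule subgroups_Inter_pair[OF T(1) N])
    have finT: "finite T" using T(2) H(3) finite_subset by blast
    have "card (T \<inter> ?N) dvd ?n" using card_subgroup_dvd[OF T(1) W _ finT] T(3) by simp
    then obtain i where i: "card (T \<inter> ?N) = q ^ i" using q by (auto simp: divides_primepow_nat)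
    have "card (T \<inter> ?N) dvd card ?N" using card_subgroup_dvd[OF N W _ finN] by simp
    then have "i \<le> multiplicity q (card ?N)"
      using i cN0 q by (metis multiplicity_geI neq0_conv not_prime_unit)
    then have "card (T \<inter> ?N) \<le> card M'"
      using i M'(4) power_increasing[OF _ prime_ge_1_nat[OF q]] by metis
    moreover have "M \<subset> T \<inter> ?N" using MT MN g T(2) by auto
    then have "card M < card (T \<inter> ?N)" using finT psubset_card_mono by (metis finite_Int)
    ultimately have lt: "card M < card M'" by simp
    have M'H: "M' \<subseteq> H" using M'(2) by auto
    have "card M' \<le> card H" using M'H H(3) card_mono by blast
    then have "card H - card M' < card H - card M" using lt by simp
    from less.hyps[OF this M'(1) M'H M'(3,4)] MM' show ?thesis by blast
  qed
qed

text \<open>A Sylow \<open>q\<close>-subgroup of the fixed points is itself invariant, so it lies in an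
  invariant Sylow \<open>q\<close>-subgroup of \<open>H\<close>. All of these are conjugate to
  \<open>S\<close> by fixed points, and such a conjugation moves it into the fixed points of
  \<open>S\<close>.\<close>
lemma sylow_part_fixed_le:
  assumes p: "Factorial_Ring.prime p" and A: "subgroup A P" "card A = p ^ k"
    and H: "subgroup H G" "stable \<phi> A H" "finite H" "\<not> p dvd card H"
    and q: "Factorial_Ring.prime q"
    and S: "subgroup S G" "S \<subseteq> H" "stable \<phi> A S" "card S = q ^ multiplicity q (card H)"
  shows "q ^ multiplicity q (card (fixed_by \<phi> A H)) \<le> card (fixed_by \<phi> A S)"
proof -
  let ?C = "fixed_by \<phi> A H"
  have C: "subgroup ?C G" using subgroup_fixed_by[OF subgroup.subset[OF A(1)] H(1)] .
  have CH: "?C \<subseteq> H" by (auto simp: fixed_by_def)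
  obtain R where R: "subgroup R G" "R \<subseteq> ?C" "card R = q ^ multiplicity q (card ?C)"
    using sylow_exists_in[OF q finite_subset[OF CH H(3)] C] by blast
  have stR: "stable \<phi> A R" using R(2) by (auto simp: stable_def fixed_by_def subset_iff)
  obtain T where T: "subgroup T G" "R \<subseteq> T" "T \<subseteq> H" "stable \<phi> A T" "card T = q ^ multiplicity q (card H)"
    using stable_sylow_above[OF p A H q R(1) _ stR R(3)] R(2) CH by blast
  obtain c where c: "c \<in> ?C" "conj_set G c T = S"
    using stable_sylow_conj[OF p A H q S T(1,3-5)] by blast
  have "conj_set G c R \<subseteq> S" using c T(2) by (auto simp: conj_set_def)
  moreover have "conj_set G c R \<subseteq> ?C" using conj_set_closed_subgroup[OF C c(1) R(2)] .
  ultimately have "conj_set G c R \<subseteq> fixed_by \<phi> A S" by (auto simp: fixed_by_def)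
  moreover have "finite (fixed_by \<phi> A S)" using finite_subset[OF S(2) H(3)] by (simp add: fixed_by_def)
  ultimately have "card (conj_set G c R) \<le> card (fixed_by \<phi> A S)" by (rule card_mono[rotated])
  then show ?thesis using R card_conj_set[of c R] subgroup.mem_carrier[OF C c(1)] subgroup.subset[OF R(1)] by simp
qed

end

section \<open>The bound for irreducible actions\<close>

text \<open>The group acts by conjugation on its nontrivial elements, whose number is prime to
  \<open>q\<close>; a fixed one is central.\<close>
lemma (in group) p_group_central_element:
  assumes q: "Factorial_Ring.prime q" and c: "card (carrier G) = q ^ a" and nt: "carrier G \<noteq> {\<one>}"
  shows "\<exists>z\<in>carrier G. z \<noteq> \<one> \<and> (\<forall>g\<in>carrier G. g \<otimes> z = z \<otimes> g)"
proof -
  have fin: "finite (carrier G)" by (rule finite_if_card_prime_power[OF q c])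
  have "card (carrier G) \<noteq> 1" using nt by (metis card_1_singletonE one_closed singletonD)
  then have "q dvd card (carrier G)" using c dvd_prime_power_cases[OF q, of "card (carrier G)" a] by auto
  moreover have "card (carrier G) = Suc (card (carrier G - {\<one>}))"
    using fin by (metis card.remove one_closed)
  ultimately have nd: "\<not> q dvd card (carrier G - {\<one>})"
    using q by (metis Suc_eq_plus1 dvd_add_right_iff nat_dvd_1_iff_1 not_prime_1)
  have "\<exists>z\<in>carrier G - {\<one>}. \<forall>g\<in>carrier G. g \<otimes> z \<otimes> inv g = z"
  proof (rule p_group_fixed_point[OF q subgroup_self c _ nd])
    show "finite (carrier G - {\<one>})" using fin by simp
    fix g z assume g: "g \<in> carrier G" and z: "z \<in> carrier G - {\<one>}"
    then have "g \<otimes> z \<otimes> inv g \<noteq> \<one>" using conj_inj[of g z \<one>] by auto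
    then show "g \<otimes> z \<otimes> inv g \<in> carrier G - {\<one>}" using g z by simp
  qed (auto simp: conj_conj)
  then obtain z where z: "z \<in> carrier G" "z \<noteq> \<one>" "\<And>g. g \<in> carrier G \<Longrightarrow> g \<otimes> z \<otimes> inv g = z" by blast
  have "g \<otimes> z = z \<otimes> g" if "g \<in> carrier G" for g
    using z(3)[OF that] z(1) that by (metis inv_solve_right m_closed)
  then show ?thesis using z by blast
qed

text \<open>In logarithmic form: over \<open>x \<in> T\<close>, the average of \<open>ln (|C(x)| /
  |C(T)|)\<close> is at most \<open>ln (|H| / |C(T)|) / p\<close>, where \<open>C\<close> denotes fixed points
  in \<open>H\<close>. Clearing denominators keeps the inequality in the natural numbers, where it is
  multiplicative in \<open>H\<close>.\<close>
definition fix_bound :: "nat \<Rightarrow> ('c \<Rightarrow> 'a \<Rightarrow> 'a) \<Rightarrow> 'c set \<Rightarrow> 'a set \<Rightarrow> bool" where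
  "fix_bound p \<phi> T H \<longleftrightarrow>
     (\<Prod>x\<in>T. card (fixed_by \<phi> {x} H)) ^ p \<le> card H ^ card T * card (fixed_by \<phi> T H) ^ ((p - 1) * card T)"

context aut_action begin

lemma act_pow_fixed:
  assumes "x \<in> carrier P" "v \<in> carrier G" "\<phi> x v = v"
  shows "\<phi> (x [^]\<^bsub>P\<^esub> (n::nat)) v = v"
  using assms by (induction n) (auto simp: act_one act_mult)

lemma act_pow_commute:
  assumes w: "w \<in> carrier P" "\<And>v. v \<in> carrier G \<Longrightarrow> \<phi> w (\<phi> x v) = \<phi> x (\<phi> w v)"
    and "x \<in> carrier P" "v \<in> carrier G"
  shows "\<phi> (w [^]\<^bsub>P\<^esub> (n::nat)) (\<phi> x v) = \<phi> x (\<phi> (w [^]\<^bsub>P\<^esub> n) v)"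
  using assms(3,4)
  by (induction n arbitrary: v) (auto simp: act_one act_mult w act_closed)

text \<open>The image of \<open>P\<close> in the automorphism group is a nontrivial \<open>p\<close>-group, so
  it has a nontrivial central element, and one of its iterated \<open>p\<close>-th powers has order exactly
  \<open>p\<close>.\<close>
lemma central_of_prime_order:
  assumes p: "Factorial_Ring.prime p" and cP: "card (carrier P) = p ^ k"
    and nt: "x0 \<in> carrier P" "v0 \<in> carrier G" "\<phi> x0 v0 \<noteq> v0"
  shows "\<exists>w\<in>carrier P. (\<exists>v\<in>carrier G. \<phi> w v \<noteq> v) \<and>
     (\<forall>x\<in>carrier P. \<forall>v\<in>carrier G. \<phi> w (\<phi> x v) = \<phi> x (\<phi> w v)) \<and>
     (\<forall>v\<in>carrier G. \<phi> (w [^]\<^bsub>P\<^esub> p) v = v)"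
proof -
  \<comment> \<open>restricting to the carrier makes \<open>f y\<close> depend only on the automorphism that \<open>y\<close> induces\<close>
  define f where "f = (\<lambda>y. restrict (\<phi> y) (carrier G))"
  have f_eq: "f x = f y \<longleftrightarrow> (\<forall>v\<in>carrier G. \<phi> x v = \<phi> y v)" for x y
    unfolding f_def by (metis restrict_apply' restrict_ext)
  have finP: "finite (carrier P)" by (rule finite_if_card_prime_power[OF p cP])
  let ?F = "f ` carrier P"
  have "card (carrier P) = card {y \<in> carrier P. f y = f \<one>\<^bsub>P\<^esub>} * card ?F"
  proof (rule P.card_eq_card_fibre_mult[OF P.subgroup_self finP])
    fix a b assume ab: "a \<in> carrier P" "b \<in> carrier P"
    show "f a = f b \<longleftrightarrow> inv\<^bsub>P\<^esub> a \<otimes>\<^bsub>P\<^esub> b \<in> {y \<in> carrier P. f y = f \<one>\<^bsub>P\<^esub>}"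
      using ab act_inv_cancel[OF ab(1)] act_closed[OF ab(2)] by (simp add: f_eq act_mult act_one) metis
  qed blast
  then have dvdF: "card ?F dvd p ^ k" using cP by (metis dvd_triv_right)
  have "f x0 \<noteq> f \<one>\<^bsub>P\<^esub>" using nt by (auto simp: f_eq act_one)
  then have "card ?F \<noteq> 1" using nt(1) by (metis P.one_closed card_1_singletonE image_eqI singletonD)
  then have "p dvd card ?F" using dvd_prime_power_cases[OF p dvdF] by blast
  moreover have "card ?F = Suc (card (?F - {f \<one>\<^bsub>P\<^esub>}))"
    by (rule card.remove) (use finP in auto)
  ultimately have nd: "\<not> p dvd card (?F - {f \<one>\<^bsub>P\<^esub>})"
    using p by (metis Suc_eq_plus1 dvd_add_right_iff nat_dvd_1_iff_1 not_prime_1)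
  define act where "act = (\<lambda>x \<alpha>. restrict (\<lambda>v. \<phi> x (\<alpha> (\<phi> (inv\<^bsub>P\<^esub> x) v))) (carrier G))"
  have act_f: "act x (f y) = f (x \<otimes>\<^bsub>P\<^esub> y \<otimes>\<^bsub>P\<^esub> inv\<^bsub>P\<^esub> x)" if "x \<in> carrier P" "y \<in> carrier P" for x y
    using that unfolding act_def f_def by (intro restrict_ext) (simp add: act_closed act_mult)
  have "\<exists>\<alpha>\<in>?F - {f \<one>\<^bsub>P\<^esub>}. \<forall>x\<in>carrier P. act x \<alpha> = \<alpha>"
  proof (rule P.p_group_fixed_point[OF p P.subgroup_self cP _ nd])
    show "finite (?F - {f \<one>\<^bsub>P\<^esub>})" using finP by simp
    fix \<alpha> assume "\<alpha> \<in> ?F - {f \<one>\<^bsub>P\<^esub>}"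
    then obtain y where y: "y \<in> carrier P" "\<alpha> = f y" "f y \<noteq> f \<one>\<^bsub>P\<^esub>" by blast
    show "act \<one>\<^bsub>P\<^esub> \<alpha> = \<alpha>" using y act_f by simp
    fix x assume x: "x \<in> carrier P"
    have "f (x \<otimes>\<^bsub>P\<^esub> y \<otimes>\<^bsub>P\<^esub> inv\<^bsub>P\<^esub> x) \<noteq> f \<one>\<^bsub>P\<^esub>"
    proof
      assume e: "f (x \<otimes>\<^bsub>P\<^esub> y \<otimes>\<^bsub>P\<^esub> inv\<^bsub>P\<^esub> x) = f \<one>\<^bsub>P\<^esub>"
      have "\<phi> y v = v" if v: "v \<in> carrier G" for v
      proof -
        have "\<phi> (x \<otimes>\<^bsub>P\<^esub> y \<otimes>\<^bsub>P\<^esub> inv\<^bsub>P\<^esub> x) (\<phi> x v) = \<phi> x v"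
          using e v x by (simp add: f_eq act_one act_closed)
        then have "\<phi> x (\<phi> y v) = \<phi> x v" using x y(1) v by (simp add: act_mult act_inv_cancel act_closed)
        then show ?thesis using act_inv_cancel(1)[OF x] v y(1) act_closed by metis
      qed
      then show False using y(3) by (simp add: f_eq act_one)
    qed
    then show "act x \<alpha> \<in> ?F - {f \<one>\<^bsub>P\<^esub>}" using act_f[OF x y(1)] y x by auto
    fix x' assume x': "x' \<in> carrier P"
    have "act x (act x' \<alpha>) = f (x \<otimes>\<^bsub>P\<^esub> (x' \<otimes>\<^bsub>P\<^esub> y \<otimes>\<^bsub>P\<^esub> inv\<^bsub>P\<^esub> x') \<otimes>\<^bsub>P\<^esub> inv\<^bsub>P\<^esub> x)"
      using act_f x x' y by simp
    then show "act (x \<otimes>\<^bsub>P\<^esub> x') \<alpha> = act x (act x' \<alpha>)"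
      using act_f[of "x \<otimes>\<^bsub>P\<^esub> x'" y] x x' y P.conj_conj[OF x x' y(1)] by simp
  qed
  then obtain z where z: "z \<in> carrier P" "f z \<noteq> f \<one>\<^bsub>P\<^esub>" "\<And>x. x \<in> carrier P \<Longrightarrow> act x (f z) = f z"
    by blast
  have zcomm: "\<phi> z (\<phi> x v) = \<phi> x (\<phi> z v)" if x: "x \<in> carrier P" and v: "v \<in> carrier G" for x v
  proof -
    have "f (x \<otimes>\<^bsub>P\<^esub> z \<otimes>\<^bsub>P\<^esub> inv\<^bsub>P\<^esub> x) = f z" using z(3)[OF x] act_f[OF x z(1)] by simp
    then have "\<phi> (x \<otimes>\<^bsub>P\<^esub> z \<otimes>\<^bsub>P\<^esub> inv\<^bsub>P\<^esub> x) (\<phi> x v) = \<phi> z (\<phi> x v)"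
      using v x by (simp add: f_eq act_closed)
    then show ?thesis using x z(1) v by (simp add: act_mult act_inv_cancel act_closed)
  qed
  let ?triv = "\<lambda>j. f (z [^]\<^bsub>P\<^esub> (p ^ j :: nat)) = f \<one>\<^bsub>P\<^esub>"
  have "z [^]\<^bsub>P\<^esub> (p ^ k) = \<one>\<^bsub>P\<^esub>" using P.pow_order_eq_1[OF z(1)] cP by (simp add: order_def)
  then have ex: "?triv k" by simp
  define j where "j = (LEAST j. ?triv j)"
  have j: "?triv j" unfolding j_def by (rule LeastI[of ?triv, OF ex])
  have "j \<noteq> 0" using j z by (metis P.nat_pow_eone power_0)
  then obtain i where i: "j = Suc i" using not0_implies_Suc by blast
  have "\<not> ?triv i" using not_less_Least[of i ?triv] i unfolding j_def by simp
  define w where "w = z [^]\<^bsub>P\<^esub> (p ^ i :: nat)"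
  have w: "w \<in> carrier P" using z by (simp add: w_def)
  have "w [^]\<^bsub>P\<^esub> p = z [^]\<^bsub>P\<^esub> (p ^ j :: nat)"
    using z(1) i by (simp add: w_def P.nat_pow_pow mult.commute)
  then have "\<forall>v\<in>carrier G. \<phi> (w [^]\<^bsub>P\<^esub> p) v = v" using j by (simp add: f_eq act_one)
  moreover have "\<exists>v\<in>carrier G. \<phi> w v \<noteq> v" using \<open>\<not> ?triv i\<close> by (simp add: w_def f_eq act_one)
  moreover have "\<forall>x\<in>carrier P. \<forall>v\<in>carrier G. \<phi> w (\<phi> x v) = \<phi> x (\<phi> w v)"
    unfolding w_def using act_pow_commute[OF z(1)] zcomm by simp
  ultimately show ?thesis using w by blast
qed

lemma act_finprod:
  assumes "comm_group G" "x \<in> carrier P" "finite I" "v \<in> I \<rightarrow> carrier G"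
  shows "\<phi> x (finprod G v I) = finprod G (\<lambda>i. \<phi> x (v i)) I"
proof -
  interpret comm_group G by (rule assms(1))
  show ?thesis using assms(3,4)
  proof (induction I rule: finite_induct)
    case empty then show ?case using act_G_one assms(2) by simp
  next
    case (insert a I)
    then have "v \<in> I \<rightarrow> carrier G" "v a \<in> carrier G" by auto
    then show ?case using insert.IH insert.hyps assms(2)
      by (simp add: act_hom act_closed Pi_def)
  qed
qed

text \<open>If \<open>P\<close> acts trivially, both sides agree. Otherwise the centre of the
  \<open>q\<close>-group \<open>G\<close> is a nontrivial invariant subgroup, so \<open>G\<close> is abelian,
  and the subgroups fixed by \<open>x w\<^sup>i\<close>, \<open>i < p\<close>, are independent. Right
  translation by \<open>w\<^sup>i\<close> permutes \<open>P\<close>, so the product over all \<open>x\<close>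
  and \<open>i\<close> is the \<open>p\<close>-th power on the left of the bound.\<close>
lemma irreducible_bound:
  assumes p: "Factorial_Ring.prime p" and cP: "card (carrier P) = p ^ k"
    and q: "Factorial_Ring.prime q" and cG: "card (carrier G) = q ^ a"
    and irr: "\<And>M. M \<lhd> G \<Longrightarrow> stable \<phi> (carrier P) M \<Longrightarrow> M = {\<one>} \<or> M = carrier G"
  shows "fix_bound p \<phi> (carrier P) (carrier G)"
proof (cases "\<forall>x\<in>carrier P. \<forall>v\<in>carrier G. \<phi> x v = v")
  case True
  then have "fixed_by \<phi> (carrier P) (carrier G) = carrier G"
    "\<And>x. x \<in> carrier P \<Longrightarrow> fixed_by \<phi> {x} (carrier G) = carrier G" by (auto simp: fixed_by_def)
  moreover have "(card (carrier G) ^ card (carrier P)) ^ p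
      = card (carrier G) ^ card (carrier P) * card (carrier G) ^ ((p - 1) * card (carrier P))"
    using prime_gt_0_nat[OF p] by (cases p) (simp_all flip: power_mult power_add add: algebra_simps)
  ultimately show ?thesis by (simp add: fix_bound_def)
next
  case False
  have finP: "finite (carrier P)" by (rule finite_if_card_prime_power[OF p cP])
  have finG: "finite (carrier G)" by (rule finite_if_card_prime_power[OF q cG])
  obtain x0 v0 where nt: "x0 \<in> carrier P" "v0 \<in> carrier G" "\<phi> x0 v0 \<noteq> v0" using False by blast
  then have "carrier G \<noteq> {\<one>}" using act_G_one by auto
  then obtain z where z: "z \<in> carrier G" "z \<noteq> \<one>" "\<forall>g\<in>carrier G. g \<otimes> z = z \<otimes> g"
    using p_group_central_element[OF q cG] by blast
  let ?Z = "{z \<in> carrier G. \<forall>g\<in>carrier G. g \<otimes> z = z \<otimes> g}"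
  have "subgroup ?Z G"
  proof (rule subgroupI)
    fix a b assume a: "a \<in> ?Z"
    have "g \<otimes> inv a = inv a \<otimes> g" if g: "g \<in> carrier G" for g
    proof -
      have aG: "a \<in> carrier G" and ag: "g \<otimes> a = a \<otimes> g" using a g by blast+
      have "inv a \<otimes> (a \<otimes> g) \<otimes> inv a = g \<otimes> inv a" using aG g by (simp add: m_assoc[symmetric])
      moreover have "inv a \<otimes> (g \<otimes> a) \<otimes> inv a = inv a \<otimes> g" using aG g by (simp add: m_assoc)
      ultimately show ?thesis unfolding ag by simp
    qed
    moreover have "inv a \<in> carrier G" using a by blast
    ultimately show "inv a \<in> ?Z" by blast
    assume b: "b \<in> ?Z"
    have "g \<otimes> (a \<otimes> b) = a \<otimes> b \<otimes> g" if g: "g \<in> carrier G" for g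
    proof -
      have G: "a \<in> carrier G" "b \<in> carrier G" and c: "g \<otimes> a = a \<otimes> g" "g \<otimes> b = b \<otimes> g" using a b g by blast+
      have "g \<otimes> (a \<otimes> b) = (a \<otimes> g) \<otimes> b" unfolding c(1)[symmetric] using G g by (simp add: m_assoc)
      also have "\<dots> = a \<otimes> (b \<otimes> g)" unfolding c(2)[symmetric] using G g by (simp add: m_assoc)
      finally show ?thesis using G g by (simp add: m_assoc)
    qed
    moreover have "a \<otimes> b \<in> carrier G" using a b by blast
    ultimately show "a \<otimes> b \<in> ?Z" by blast
  next
    have "\<one> \<in> ?Z" by simp
    then show "?Z \<noteq> {}" by blast
  qed blast
  moreover have "x \<otimes> h \<otimes> inv x \<in> ?Z" if "x \<in> carrier G" "h \<in> ?Z" for x h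
  proof -
    have "x \<otimes> h = h \<otimes> x" "h \<in> carrier G" using that by blast+
    then have "x \<otimes> h \<otimes> inv x = h" using that(1) by (simp add: m_assoc)
    then show ?thesis using that by argo
  qed
  ultimately have nZ: "?Z \<lhd> G" by (simp add: normal_inv_iff)
  have sZ: "stable \<phi> (carrier P) ?Z"
    unfolding stable_def
  proof (intro ballI)
    fix x h assume x: "x \<in> carrier P" and h: "h \<in> ?Z"
    have "g \<otimes> \<phi> x h = \<phi> x h \<otimes> g" if g: "g \<in> carrier G" for g
    proof -
      let ?g = "\<phi> (inv\<^bsub>P\<^esub> x) g"
      have g': "?g \<in> carrier G" "\<phi> x ?g = g" using x g act_closed act_inv_cancel by auto
      have hG: "h \<in> carrier G" and "?g \<otimes> h = h \<otimes> ?g" using h g' by blast+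
      then have "\<phi> x (?g \<otimes> h) = \<phi> x (h \<otimes> ?g)" by simp
      then show ?thesis using act_hom[OF x g'(1) hG] act_hom[OF x hG g'(1)] g'(2) by simp
    qed
    moreover have "\<phi> x h \<in> carrier G" using x h act_closed by blast
    ultimately show "\<phi> x h \<in> ?Z" by blast
  qed
  from irr[OF nZ sZ] have Z: "?Z = carrier G" using z by auto
  have comm: "g \<otimes> h = h \<otimes> g" if "g \<in> carrier G" "h \<in> carrier G" for g h
  proof -
    have "h \<in> ?Z" using Z that by blast
    then show ?thesis using that by blast
  qed
  then have cg: "comm_group G" by (rule group_comm_groupI)
  interpret comm_group G by (rule cg)
  obtain w where w: "w \<in> carrier P" "\<exists>v\<in>carrier G. \<phi> w v \<noteq> v"
    "\<And>x v. x \<in> carrier P \<Longrightarrow> v \<in> carrier G \<Longrightarrow> \<phi> w (\<phi> x v) = \<phi> x (\<phi> w v)"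
    "\<And>v. v \<in> carrier G \<Longrightarrow> \<phi> (w [^]\<^bsub>P\<^esub> p) v = v"
    using central_of_prime_order[OF p cP nt] by blast
  let ?w = "\<lambda>i::nat. w [^]\<^bsub>P\<^esub> i"
  have wP: "?w i \<in> carrier P" for i using w(1) by simp
  have wcomm: "\<phi> (?w i) (\<phi> x v) = \<phi> x (\<phi> (?w i) v)" if "x \<in> carrier P" "v \<in> carrier G" for i x v
    using act_pow_commute[OF w(1) _ that] w(3) that by blast
  \<comment> \<open>the fixed points of \<open>w\<^sup>i\<close> are an invariant subgroup, proper because \<open>w\<close> is a power of \<open>w\<^sup>i\<close> up to the kernel of the action\<close>
  have wfree: "v = \<one>" if v: "v \<in> carrier G" and i: "0 < i" "i < p" and fx: "\<phi> (?w i) v = v" for v i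
  proof -
    let ?F = "fixed_by \<phi> {?w i} (carrier G)"
    have "subgroup ?F G" using subgroup_fixed_by[OF _ subgroup_self] wP by simp
    then have nF: "?F \<lhd> G" by (rule subgroup_imp_normal)
    have sF: "stable \<phi> (carrier P) ?F"
      unfolding stable_def fixed_by_def using wcomm act_closed by auto
    have "?F \<noteq> carrier G"
    proof
      assume F: "?F = carrier G"
      have "coprime i p" using i p by (metis coprime_commute nat_dvd_not_less prime_imp_coprime)
      then obtain u t where ut: "i * u = p * t + 1" using bezout_nat[of i p] i by (metis coprime_imp_gcd_eq_1 not_gr0)
      obtain v where v: "v \<in> carrier G" "\<phi> w v \<noteq> v" using w(2) by blast
      have "\<phi> (?w i) v = v" using F v(1) by (auto simp: fixed_by_def)
      then have "\<phi> (?w i [^]\<^bsub>P\<^esub> u) v = v" using act_pow_fixed wP v(1) by simp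
      then have "\<phi> (?w (Suc (p * t))) v = v" using ut w(1) by (simp add: P.nat_pow_pow)
      then have "\<phi> (?w (p * t)) (\<phi> w v) = v" using wP w(1) v(1) by (simp add: act_mult)
      then have "\<phi> w (\<phi> (?w (p * t)) v) = v" using wcomm w(1) v(1) by simp
      moreover have "\<phi> (?w (p * t)) v = v"
        using act_pow_fixed[OF wP v(1) w(4)[OF v(1)], of t] w(1) by (simp add: P.nat_pow_pow)
      ultimately show False using v(2) by simp
    qed
    then have "?F = {\<one>}" using irr[OF nF sF] by blast
    moreover have "v \<in> ?F" using v fx by (simp add: fixed_by_def)
    ultimately show ?thesis by simp
  qed
  define C where "C = (\<lambda>x i. fixed_by \<phi> {x \<otimes>\<^bsub>P\<^esub> ?w i} (carrier G))"
  have CG: "C x i \<subseteq> carrier G" for x i by (auto simp: C_def fixed_by_def)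
  have inter: "v = \<one>" if x: "x \<in> carrier P" and ij: "i < j" "j < p" and v: "v \<in> C x i" "v \<in> C x j" for x i j v
  proof -
    have vG: "v \<in> carrier G" using v CG by blast
    have "\<phi> x (\<phi> (?w i) v) = v" "\<phi> x (\<phi> (?w j) v) = v"
      using v x wP vG by (auto simp: C_def fixed_by_def act_mult)
    then have "\<phi> (?w i) v = \<phi> (?w j) v" using act_inv_cancel(1)[OF x] act_closed wP vG by metis
    moreover have "?w j = ?w i \<otimes>\<^bsub>P\<^esub> ?w (j - i)" using ij w(1) by (simp add: P.nat_pow_mult)
    ultimately have "\<phi> (?w i) v = \<phi> (?w i) (\<phi> (?w (j - i)) v)" using act_mult wP vG by simp
    then have "\<phi> (?w (j - i)) v = v" using act_inv_cancel(1)[OF wP[of i]] act_closed wP vG by metis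
    then show ?thesis using wfree[OF vG, of "j - i"] ij by simp
  qed
  \<comment> \<open>as for eigenvectors: applying \<open>\<phi> y - 1\<close> to a relation kills the component \<open>k\<close> and shortens it\<close>
  have indep: "\<forall>i\<in>I. v i = \<one>"
    if x: "x \<in> carrier P" and fI: "finite I" and I: "I \<subseteq> {..<p}" and v: "\<And>i. i \<in> I \<Longrightarrow> v i \<in> C x i"
      and one: "finprod G v I = \<one>" for x I v
    using fI I v one
  proof (induction I arbitrary: v rule: finite_induct)
    case empty then show ?case by simp
  next
    case (insert k I)
    define y where "y = x \<otimes>\<^bsub>P\<^esub> ?w k"
    have yP: "y \<in> carrier P" using x wP by (simp add: y_def)
    have vG: "v i \<in> carrier G" if "i \<in> insert k I" for i using insert.prems(2)[OF that] CG by blast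
    have vpi: "v \<in> I \<rightarrow> carrier G" using vG by auto
    have pr: "v k \<otimes> finprod G v I = \<one>" using insert.prems(3) insert.hyps vG vpi by simp
    have fG: "finprod G v I \<in> carrier G" using vpi by simp
    have vk: "\<phi> y (v k) = v k" using insert.prems(2)[of k] by (simp add: C_def fixed_by_def y_def)
    have "\<phi> y (v k \<otimes> finprod G v I) = v k \<otimes> \<phi> y (finprod G v I)"
      using act_hom[OF yP vG[of k] fG] vk by simp
    then have "v k \<otimes> \<phi> y (finprod G v I) = v k \<otimes> finprod G v I" using act_G_one[OF yP] pr by simp
    then have fy: "\<phi> y (finprod G v I) = finprod G v I" using vG fG act_closed[OF yP fG] by simp
    let ?u = "\<lambda>i. \<phi> y (v i) \<otimes> inv (v i)"
    have uC: "?u i \<in> C x i" if i: "i \<in> I" for i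
    proof -
      have viG: "v i \<in> carrier G" using vG i by blast
      have e: "\<phi> x (\<phi> (?w i) (v i)) = v i"
        using insert.prems(2)[of i] i x wP viG by (simp add: C_def fixed_by_def act_mult)
      have "\<phi> (x \<otimes>\<^bsub>P\<^esub> ?w i) (\<phi> y (v i)) = \<phi> x (\<phi> (?w k) (\<phi> x (\<phi> (?w i) (v i))))"
        using wcomm[OF x act_closed[OF wP viG], of i k] wcomm[OF x act_closed[OF wP viG], of k i]
          wcomm[OF wP viG, of i k] x wP viG by (simp add: y_def act_mult act_closed)
      also have "\<dots> = \<phi> y (v i)" using e x wP viG by (simp add: y_def act_mult)
      finally have "\<phi> y (v i) \<in> C x i" using act_closed yP viG by (simp add: C_def fixed_by_def)
      moreover have "subgroup (C x i) G" unfolding C_def using subgroup_fixed_by[OF _ subgroup_self] x wP by simp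
      ultimately show ?thesis using insert.prems(2)[of i] i by (meson insertI2 subgroup.m_closed subgroup.m_inv_closed)
    qed
    have upi: "?u \<in> I \<rightarrow> carrier G" using uC CG by blast
    have "finprod G ?u I \<otimes> finprod G v I = finprod G (\<lambda>i. ?u i \<otimes> v i) I"
      using finprod_multf[OF upi vpi] by simp
    also have "\<dots> = finprod G (\<lambda>i. \<phi> y (v i)) I"
      by (rule finprod_cong') (use vG yP act_closed in \<open>auto simp: m_assoc\<close>)
    also have "\<dots> = finprod G v I" using act_finprod[OF cg yP insert.hyps(1) vpi] fy by simp
    finally have "finprod G ?u I = \<one>" using fG upi by simp
    then have u1: "\<forall>i\<in>I. ?u i = \<one>"
      using insert.IH[of ?u] uC insert.prems(1) by simp
    have vI: "v i = \<one>" if i: "i \<in> I" for i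
    proof -
      have viG: "v i \<in> carrier G" using vG i by blast
      have "\<phi> y (v i) = v i" using u1 i viG yP act_closed by (metis inv_equality inv_inv inv_closed)
      then have "v i \<in> C x k" using viG by (simp add: C_def fixed_by_def y_def)
      moreover have "v i \<in> C x i" using insert.prems(2) i by blast
      moreover have "i < p" "k < p" "i \<noteq> k" using insert.prems(1) insert.hyps i by auto
      ultimately show ?thesis using inter[OF x, of i k] inter[OF x, of k i] by (metis nat_neq_iff)
    qed
    then have "finprod G v I = \<one>" by (rule finprod_one_eqI)
    then show ?case using vI pr vG by simp
  qed
  have prod_le: "(\<Prod>i<p. card (C x i)) \<le> card (carrier G)" if x: "x \<in> carrier P" for x
  proof -
    have "inj_on (\<lambda>v. finprod G v {..<p}) (PiE {..<p} (C x))"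
    proof (rule inj_onI)
      fix u v assume u: "u \<in> PiE {..<p} (C x)" and v: "v \<in> PiE {..<p} (C x)"
        and e: "finprod G u {..<p} = finprod G v {..<p}"
      have uv: "u i \<in> C x i" "v i \<in> C x i" if "i < p" for i using u v that by auto
      then have G: "u \<in> {..<p} \<rightarrow> carrier G" "v \<in> {..<p} \<rightarrow> carrier G" using CG by blast+
      let ?d = "\<lambda>i. u i \<otimes> inv (v i)"
      have dC: "?d i \<in> C x i" if "i \<in> {..<p}" for i
      proof -
        have "subgroup (C x i) G" unfolding C_def using subgroup_fixed_by[OF _ subgroup_self] x wP by simp
        then show ?thesis using uv[of i] that by (simp add: subgroup.m_closed subgroup.m_inv_closed)
      qed
      then have dG: "?d \<in> {..<p} \<rightarrow> carrier G" using CG by blast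
      have "finprod G ?d {..<p} \<otimes> finprod G v {..<p} = finprod G (\<lambda>i. ?d i \<otimes> v i) {..<p}"
        using finprod_multf[OF dG G(2)] by simp
      also have "\<dots> = finprod G u {..<p}"
        by (rule finprod_cong') (use G in \<open>auto simp: m_assoc Pi_def\<close>)
      finally have "finprod G ?d {..<p} = \<one>" using e G dG by simp
      then have "\<forall>i\<in>{..<p}. ?d i = \<one>" using indep[OF x finite_lessThan subset_refl, of ?d] dC by simp
      then have "u i = v i" if "i < p" for i
        using that G by (metis (no_types, lifting) PiE funcset_mem inv_equality inv_inv inv_closed lessThan_iff)
      then show "u = v" using u v by (intro PiE_ext) auto
    qed
    moreover have "(\<lambda>v. finprod G v {..<p}) ` PiE {..<p} (C x) \<subseteq> carrier G"
      using CG by (auto intro!: finprod_closed)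
    ultimately have "card (PiE {..<p} (C x)) \<le> card (carrier G)" using finG card_inj_on_le by blast
    then show ?thesis by (simp add: card_PiE)
  qed
  have shift: "(\<Prod>x\<in>carrier P. card (C x i)) = (\<Prod>x\<in>carrier P. card (fixed_by \<phi> {x} (carrier G)))" for i
    unfolding C_def
    by (rule prod.reindex_bij_betw[where h = "\<lambda>x. x \<otimes>\<^bsub>P\<^esub> ?w i"],
        rule bij_betwI[where g = "\<lambda>x. x \<otimes>\<^bsub>P\<^esub> inv\<^bsub>P\<^esub> (?w i)"])
       (use wP in \<open>auto simp: P.m_assoc\<close>)
  have "(\<Prod>x\<in>carrier P. card (fixed_by \<phi> {x} (carrier G))) ^ p = (\<Prod>i<p. \<Prod>x\<in>carrier P. card (C x i))"
    by (simp add: shift)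
  also have "\<dots> = (\<Prod>x\<in>carrier P. \<Prod>i<p. card (C x i))" by (rule prod.swap)
  also have "\<dots> \<le> (\<Prod>x\<in>carrier P. card (carrier G))" by (intro prod_mono) (use prod_le in auto)
  also have "\<dots> = card (carrier G) ^ card (carrier P) * 1" by simp
  also have "\<dots> \<le> card (carrier G) ^ card (carrier P) * card (fixed_by \<phi> (carrier P) (carrier G)) ^ ((p - 1) * card (carrier P))"
  proof -
    have "\<one> \<in> fixed_by \<phi> (carrier P) (carrier G)" by (simp add: fixed_by_def act_G_one)
    moreover have "finite (fixed_by \<phi> (carrier P) (carrier G))" using finG by (simp add: fixed_by_def)
    ultimately have "card (fixed_by \<phi> (carrier P) (carrier G)) \<ge> 1" by (metis One_nat_def Suc_leI card_gt_0_iff empty_iff)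
    then show ?thesis by simp
  qed
  finally show ?thesis by (simp add: fix_bound_def)
qed

end

section \<open>Extensions, and the bound for coprime actions\<close>

lemma fixed_by_mono: "H \<subseteq> K \<Longrightarrow> fixed_by \<phi> A H \<subseteq> fixed_by \<phi> A K"
  by (auto simp: fixed_by_def)

context aut_action begin

lemma aut_action_subgroup:
  assumes H: "subgroup H G" and st: "stable \<phi> (carrier P) H"
  shows "aut_action (G\<lparr>carrier := H\<rparr>) P \<phi>"
proof -
  interpret H: group "G\<lparr>carrier := H\<rparr>" using H by (rule subgroup_imp_group)
  interpret S: subgroup H G by (rule H)
  show ?thesis
    by unfold_locales (use st in \<open>auto simp: stable_def act_hom act_mult act_one\<close>)
qed

lemma act_rcoset:
  assumes M: "subgroup M G" "stable \<phi> (carrier P) M" and x: "x \<in> carrier P" and g: "g \<in> carrier G"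
  shows "\<phi> x ` (M #> g) = M #> \<phi> x g"
proof -
  have MG: "M \<subseteq> carrier G" using M(1) subgroup.subset by blast
  have "\<phi> x ` (M #> g) = (\<lambda>m. \<phi> x m \<otimes> \<phi> x g) ` M"
    using x g MG by (force simp: r_coset_def act_hom subset_iff)
  also have "\<dots> = \<phi> x ` M #> \<phi> x g" by (auto simp: r_coset_def)
  finally show ?thesis using stable_image_eq[OF P.subgroup_self MG M(2) x] by simp
qed

lemma aut_action_quotient:
  assumes M: "M \<lhd> G" "stable \<phi> (carrier P) M"
  shows "aut_action (G Mod M) P (\<lambda>x C. \<phi> x ` C)"
proof -
  interpret M: normal M G by (rule M)
  interpret Q: group "G Mod M" by (rule M.factorgroup_is_group)
  note co = act_rcoset[OF M.subgroup_axioms M(2)]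
  show ?thesis
  proof unfold_locales
    fix x C assume x: "x \<in> carrier P" and "C \<in> carrier (G Mod M)"
    then obtain g where g: "g \<in> carrier G" "C = M #> g" by (auto simp: carrier_FactGroup)
    show "\<phi> x ` C \<in> carrier (G Mod M)" using x g co act_closed by (auto simp: carrier_FactGroup)
    fix D assume "D \<in> carrier (G Mod M)"
    then obtain h where h: "h \<in> carrier G" "D = M #> h" by (auto simp: carrier_FactGroup)
    show "\<phi> x ` (C \<otimes>\<^bsub>G Mod M\<^esub> D) = \<phi> x ` C \<otimes>\<^bsub>G Mod M\<^esub> \<phi> x ` D"
      using x g h co act_closed by (simp add: M.rcos_sum act_hom)
  next
    fix x y C assume xy: "x \<in> carrier P" "y \<in> carrier P" and "C \<in> carrier (G Mod M)"
    then obtain g where g: "g \<in> carrier G" "C = M #> g" by (auto simp: carrier_FactGroup)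
    then show "\<phi> (x \<otimes>\<^bsub>P\<^esub> y) ` C = \<phi> x ` \<phi> y ` C" using xy co act_closed act_mult by simp
  next
    fix C assume "C \<in> carrier (G Mod M)"
    then obtain g where g: "g \<in> carrier G" "C = M #> g" by (auto simp: carrier_FactGroup)
    then show "\<phi> \<one>\<^bsub>P\<^esub> ` C = C" using co act_one by simp
  qed
qed

text \<open>Every fixed coset of \<open>M\<close> contains a fixed point, since the action is coprime on
  \<open>M\<close>.\<close>
lemma card_fixed_quotient:
  assumes p: "Factorial_Ring.prime p" and cP: "card (carrier P) = p ^ k"
    and M: "M \<lhd> G" "stable \<phi> (carrier P) M" and fin: "finite (carrier G)" and nd: "\<not> p dvd card M"
    and A: "A \<subseteq> carrier P"
  shows "card (fixed_by \<phi> A (carrier G)) =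
    card (fixed_by \<phi> A M) * card (fixed_by (\<lambda>x C. \<phi> x ` C) A (carrier (G Mod M)))"
proof -
  interpret M: normal M G by (rule M)
  interpret Q: aut_action "G Mod M" P "\<lambda>x C. \<phi> x ` C" by (rule aut_action_quotient[OF M])
  note co = act_rcoset[OF M.subgroup_axioms M(2)]
  let ?A = "generate P A" and ?F = "fixed_by \<phi> (generate P A) (carrier G)"
  have A': "subgroup ?A P" by (rule P.generate_is_subgroup[OF A])
  have AP: "x \<in> carrier P" if "x \<in> ?A" for x using that A' subgroup.mem_carrier by metis
  have finP: "finite (carrier P)" by (rule finite_if_card_prime_power[OF p cP])
  have "card ?A dvd p ^ k"
    using P.card_subgroup_dvd[OF P.subgroup_self A' _ finP] subgroup.subset[OF A'] cP by simp
  then obtain k' where cA: "card ?A = p ^ k'" using p by (auto simp: divides_primepow_nat)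
  have stM: "stable \<phi> ?A M" using M(2) AP by (auto simp: stable_def)
  have F: "subgroup ?F G" using subgroup_fixed_by[OF subgroup.subset[OF A'] subgroup_self] .
  have FM: "fixed_by \<phi> ?A M \<subseteq> ?F" by (rule fixed_by_mono) (rule M.subset)
  have finM: "finite M" using fin M.subset finite_subset by blast
  have "card ?F = card (fixed_by \<phi> ?A M) * card ((\<lambda>g. M #> g) ` ?F)"
  proof (rule card_eq_card_fibre_mult[OF F])
    show "finite ?F" using fin by (simp add: fixed_by_def)
    show "fixed_by \<phi> ?A M \<subseteq> ?F" by (rule FM)
    fix a b assume a: "a \<in> ?F" and b: "b \<in> ?F"
    have G: "a \<in> carrier G" "b \<in> carrier G" using a b by (auto simp: fixed_by_def)
    have "inv a \<otimes> b \<in> ?F" using a b F by (simp add: subgroup.m_closed subgroup.m_inv_closed)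
    then have "inv a \<otimes> b \<in> fixed_by \<phi> ?A M \<longleftrightarrow> inv a \<otimes> b \<in> M" by (auto simp: fixed_by_def)
    also have "\<dots> \<longleftrightarrow> M #> a = M #> b" using normal_rcoset_eq_iff[OF M(1) G] by blast
    finally show "M #> a = M #> b \<longleftrightarrow> inv a \<otimes> b \<in> fixed_by \<phi> ?A M" by blast
  qed
  also have "(\<lambda>g. M #> g) ` ?F = fixed_by (\<lambda>x C. \<phi> x ` C) ?A (carrier (G Mod M))"
  proof
    show "(\<lambda>g. M #> g) ` ?F \<subseteq> fixed_by (\<lambda>x C. \<phi> x ` C) ?A (carrier (G Mod M))"
    proof
      fix C assume "C \<in> (\<lambda>g. M #> g) ` ?F"
      then obtain g where g: "g \<in> carrier G" "C = M #> g" "\<And>x. x \<in> ?A \<Longrightarrow> \<phi> x g = g"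
        by (auto simp: fixed_by_def)
      have "\<phi> x ` C = C" if "x \<in> ?A" for x using co[OF AP[OF that] g(1)] g(2) g(3)[OF that] by simp
      then show "C \<in> fixed_by (\<lambda>x C. \<phi> x ` C) ?A (carrier (G Mod M))"
        using g by (auto simp: fixed_by_def carrier_FactGroup)
    qed
    show "fixed_by (\<lambda>x C. \<phi> x ` C) ?A (carrier (G Mod M)) \<subseteq> (\<lambda>g. M #> g) ` ?F"
    proof
      fix C assume C: "C \<in> fixed_by (\<lambda>x C. \<phi> x ` C) ?A (carrier (G Mod M))"
      then obtain g where g: "g \<in> carrier G" "C = M #> g" by (auto simp: fixed_by_def carrier_FactGroup)
      have "\<phi> x g \<in> M #> g" if x: "x \<in> ?A" for x
      proof -
        have "\<phi> x ` (M #> g) = M #> g" using C g(2) x by (simp add: fixed_by_def)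
        then show ?thesis using rcos_self[OF g(1) M.subgroup_axioms] by blast
      qed
      then obtain h where h: "h \<in> M #> g" "\<forall>x\<in>?A. \<phi> x h = h"
        using fixed_point_in_coset[OF p A' cA M.subgroup_axioms stM finM nd g(1)] by blast
      have "h \<in> carrier G" using h(1) r_coset_subset_G[OF M.subset g(1)] by blast
      moreover have "C = M #> h" using g repr_independence[OF h(1) g(1) M.subgroup_axioms] by simp
      ultimately show "C \<in> (\<lambda>g. M #> g) ` ?F" using h(2) by (auto simp: fixed_by_def)
    qed
  qed
  finally show ?thesis
    using fixed_by_generate[OF A subset_refl] fixed_by_generate[OF A M.subset]
      Q.fixed_by_generate[OF A subset_refl] by simp
qed

lemma fix_bound_extension:
  assumes p: "Factorial_Ring.prime p" and cP: "card (carrier P) = p ^ k"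
    and M: "M \<lhd> G" "stable \<phi> (carrier P) M" and fin: "finite (carrier G)" and nd: "\<not> p dvd card M"
    and b1: "fix_bound p \<phi> (carrier P) M"
    and b2: "fix_bound p (\<lambda>x C. \<phi> x ` C) (carrier P) (carrier (G Mod M))"
  shows "fix_bound p \<phi> (carrier P) (carrier G)"
proof -
  interpret M: normal M G by (rule M)
  let ?\<psi> = "\<lambda>x C. \<phi> x ` C" and ?Q = "carrier (G Mod M)"
  have c: "card (carrier G) = card M * card ?Q"
    using lagrange[OF M.subgroup_axioms] by (simp add: order_def FactGroup_def mult.commute)
  note cf = card_fixed_quotient[OF p cP M fin nd]
  have "(\<Prod>x\<in>carrier P. card (fixed_by \<phi> {x} (carrier G))) ^ p =
    (\<Prod>x\<in>carrier P. card (fixed_by \<phi> {x} M) * card (fixed_by ?\<psi> {x} ?Q)) ^ p"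
    by (intro arg_cong[where f = "\<lambda>t. t ^ p"] prod.cong refl cf) simp
  also have "\<dots> = (\<Prod>x\<in>carrier P. card (fixed_by \<phi> {x} M)) ^ p * (\<Prod>x\<in>carrier P. card (fixed_by ?\<psi> {x} ?Q)) ^ p"
    by (simp add: prod.distrib power_mult_distrib)
  also have "\<dots> \<le> (card M ^ card (carrier P) * card (fixed_by \<phi> (carrier P) M) ^ ((p - 1) * card (carrier P))) *
     (card ?Q ^ card (carrier P) * card (fixed_by ?\<psi> (carrier P) ?Q) ^ ((p - 1) * card (carrier P)))"
    using b1 b2 unfolding fix_bound_def by (rule mult_le_mono)
  also have "\<dots> = card (carrier G) ^ card (carrier P) * card (fixed_by \<phi> (carrier P) (carrier G)) ^ ((p - 1) * card (carrier P))"
    by (simp add: cf[OF subset_refl] c power_mult_distrib algebra_simps)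
  finally show ?thesis by (simp add: fix_bound_def)
qed

text \<open>An invariant normal subgroup of the quotient has an invariant normal preimage between
  \<open>M\<close> and \<open>G\<close>.\<close>
lemma maximal_quotient_irreducible:
  assumes M: "M \<lhd> G" "stable \<phi> (carrier P) M"
    and max: "\<And>N. N \<lhd> G \<Longrightarrow> stable \<phi> (carrier P) N \<Longrightarrow> M \<subseteq> N \<Longrightarrow> N = M \<or> N = carrier G"
    and N: "N \<lhd> (G Mod M)" "stable (\<lambda>x C. \<phi> x ` C) (carrier P) N"
  shows "N = {\<one>\<^bsub>G Mod M\<^esub>} \<or> N = carrier (G Mod M)"
proof -
  interpret M: normal M G by (rule M)
  interpret N: normal N "G Mod M" by (rule N)
  note Ns_one = subgroup.one_closed[OF N.subgroup_axioms, unfolded one_FactGroup]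
  interpret Q: group "G Mod M" by (rule M.factorgroup_is_group)
  interpret h: group_hom G "G Mod M" "\<lambda>g. M #> g"
    by unfold_locales (rule M.r_coset_hom_Mod)
  let ?N = "{g \<in> carrier G. M #> g \<in> N}"
  have sub: "subgroup ?N G"
  proof (rule subgroupI)
    have "M \<in> N" by (rule Ns_one)
    then have "\<one> \<in> ?N" by (simp add: coset_mult_one M.subset)
    then show "?N \<noteq> {}" by blast
    fix a b assume a: "a \<in> ?N"
    have "M #> inv a = inv\<^bsub>G Mod M\<^esub> (M #> a)" using a h.hom_inv by blast
    then show "inv a \<in> ?N" using a subgroup.m_inv_closed[OF N.subgroup_axioms] by auto
    assume b: "b \<in> ?N"
    have "M #> (a \<otimes> b) = (M #> a) \<otimes>\<^bsub>G Mod M\<^esub> (M #> b)" using a b by (intro h.hom_mult) auto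
    then show "a \<otimes> b \<in> ?N" using a b subgroup.m_closed[OF N.subgroup_axioms] by auto
  qed blast
  have nN: "?N \<lhd> G"
    unfolding normal_inv_iff
  proof (intro conjI ballI sub)
    fix x h assume x: "x \<in> carrier G" and h: "h \<in> ?N"
    have hG: "h \<in> carrier G" and hN: "M #> h \<in> N" using h by blast+
    have "M #> (x \<otimes> h \<otimes> inv x) = (M #> x) \<otimes>\<^bsub>G Mod M\<^esub> (M #> h) \<otimes>\<^bsub>G Mod M\<^esub> inv\<^bsub>G Mod M\<^esub> (M #> x)"
      using h.hom_mult[of "x \<otimes> h" "inv x"] h.hom_mult[OF x hG] h.hom_inv[OF x] x hG by simp
    moreover have "\<dots> \<in> N" using N.inv_op_closed2[OF _ hN] h.hom_closed[OF x] by blast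
    ultimately show "x \<otimes> h \<otimes> inv x \<in> ?N" using x hG by simp
  qed
  have sN: "stable \<phi> (carrier P) ?N"
    unfolding stable_def
  proof (intro ballI)
    fix x g assume x: "x \<in> carrier P" and g: "g \<in> ?N"
    then have "\<phi> x ` (M #> g) \<in> N" using N(2) unfolding stable_def by blast
    then show "\<phi> x g \<in> ?N" using act_rcoset[OF M.subgroup_axioms M(2) x] act_closed[OF x] g by simp
  qed
  have "M #> m \<in> N" if "m \<in> M" for m
    using coset_join2[OF _ M.subgroup_axioms that] M.subset that Ns_one by auto
  then have MN: "M \<subseteq> ?N" using M.subset by blast
  have N_eq: "N = (\<lambda>g. M #> g) ` ?N" 
  proof
    show "N \<subseteq> (\<lambda>g. M #> g) ` ?N"
    proof
      fix C assume C: "C \<in> N"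
      then have "C \<in> carrier (G Mod M)" using N.subset by blast
      then obtain g where "g \<in> carrier G" "C = M #> g" unfolding carrier_FactGroup by blast
      then show "C \<in> (\<lambda>g. M #> g) ` ?N" using C by blast
    qed
  qed blast
  from max[OF nN sN MN] show ?thesis
  proof
    assume e: "?N = M"
    have "C = M" if "C \<in> N" for C
    proof -
      have "C \<in> (\<lambda>g. M #> g) ` ?N" using that N_eq by (rule back_subst)
      then obtain g where g: "g \<in> ?N" "C = M #> g" by (rule imageE)
      have "g \<in> carrier G" using g(1) by simp
      moreover have "g \<in> M" using g(1) e by (rule back_subst)
      ultimately
      show ?thesis using coset_join2[of g M] g(2) M.subgroup_axioms by simp
    qed
    then have "N = {M}" using Ns_one by blast
    then show ?thesis by simp
  next
    assume e: "?N = carrier G"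
    show ?thesis using N_eq unfolding e carrier_FactGroup by (rule disjI2)
  qed
qed

text \<open>Induction passes to a maximal invariant normal subgroup and not to a quotient: the quotient is
  needed only once in each step, as an irreducible action, so that the induction stays within subsets of one
  carrier type.\<close>
lemma p_group_bound:
  assumes p: "Factorial_Ring.prime p" and cP: "card (carrier P) = p ^ k"
    and q: "Factorial_Ring.prime q" "p \<noteq> q"
    and H: "subgroup H G" "stable \<phi> (carrier P) H" "card H = q ^ a"
  shows "fix_bound p \<phi> (carrier P) H"
  using H
proof (induction "card H" arbitrary: H a rule: less_induct)
  case less
  interpret HA: aut_action "G\<lparr>carrier := H\<rparr>" P \<phi> by (rule aut_action_subgroup[OF less.prems(1,2)])
  interpret H: subgroup H G by (rule less.prems(1))
  have finH: "finite H" by (rule finite_if_card_prime_power[OF q(1) less.prems(3)])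
  show ?case
  proof (cases "H = {\<one>}")
    case True
    then have "fixed_by \<phi> A H = {\<one>}" if "A \<subseteq> carrier P" for A
      using that act_G_one by (auto simp: fixed_by_def)
    then show ?thesis using True by (simp add: fix_bound_def)
  next
    case False
    let ?S = "{M. M \<lhd> G\<lparr>carrier := H\<rparr> \<and> stable \<phi> (carrier P) M \<and> M \<noteq> H}"
    have "?S \<subseteq> Pow H" using subgroup.subset[OF normal_imp_subgroup] by fastforce
    then have finS: "finite ?S" using finH finite_subset by blast
    have "{\<one>} \<in> ?S" using False HA.one_is_normal act_G_one by (auto simp: stable_def)
    then obtain M where M: "M \<in> ?S" "\<And>N. N \<in> ?S \<Longrightarrow> M \<subseteq> N \<Longrightarrow> N = M"
      using finite_has_maximal[OF finS] by blast
    have nM: "M \<lhd> G\<lparr>carrier := H\<rparr>" and sM: "stable \<phi> (carrier P) M" and MH: "M \<noteq> H" using M by auto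
    have MsH: "subgroup M (G\<lparr>carrier := H\<rparr>)" using nM by (rule normal_imp_subgroup)
    have Msub: "M \<subset> H" using subgroup.subset[OF MsH] MH by auto
    have sMG: "subgroup M G" using incl_subgroup[OF less.prems(1) MsH] .
    have "card M dvd q ^ a" using card_subgroup_dvd[OF less.prems(1) sMG _ finH] Msub less.prems(3) by auto
    then obtain b where b: "card M = q ^ b" using q by (auto simp: divides_primepow_nat)
    have nd: "\<not> p dvd card M" using b p q by (metis prime_dvd_power primes_dvd_imp_eq)
    have b1: "fix_bound p \<phi> (carrier P) M"
      using less.hyps[OF _ sMG sM b] psubset_card_mono[OF finH Msub] by blast
    interpret Q: aut_action "G\<lparr>carrier := H\<rparr> Mod M" P "\<lambda>x C. \<phi> x ` C"
      by (rule HA.aut_action_quotient[OF nM sM])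
    have "card (carrier (G\<lparr>carrier := H\<rparr> Mod M)) dvd q ^ a"
      using HA.lagrange[OF MsH] less.prems(3) by (simp add: order_def FactGroup_def) (metis dvd_triv_left)
    then obtain c where c: "card (carrier (G\<lparr>carrier := H\<rparr> Mod M)) = q ^ c" using q by (auto simp: divides_primepow_nat)
    have b2: "fix_bound p (\<lambda>x C. \<phi> x ` C) (carrier P) (carrier (G\<lparr>carrier := H\<rparr> Mod M))"
    proof (rule Q.irreducible_bound[OF p cP q(1) c])
      fix N assume N: "N \<lhd> G\<lparr>carrier := H\<rparr> Mod M" "stable (\<lambda>x C. \<phi> x ` C) (carrier P) N"
      show "N = {\<one>\<^bsub>G\<lparr>carrier := H\<rparr> Mod M\<^esub>} \<or> N = carrier (G\<lparr>carrier := H\<rparr> Mod M)"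
        by (rule HA.maximal_quotient_irreducible[OF nM sM _ N]) (use M(2) in auto)
    qed
    show ?thesis using HA.fix_bound_extension[OF p cP nM sM _ nd b1 b2] finH by simp
  qed
qed

end

lemma prod_prime_parts:
  fixes n N :: nat
  assumes "n dvd N" "N > 0"
  shows "n = (\<Prod>q\<in>prime_factors N. q ^ multiplicity q n)"
proof -
  have n: "n > 0" using assms by (metis dvd_0_left neq0_conv)
  have "(\<Prod>q\<in>prime_factors N. q ^ multiplicity q n) = (\<Prod>q\<in>prime_factors n. q ^ multiplicity q n)"
  proof (rule prod.mono_neutral_right)
    show "prime_factors n \<subseteq> prime_factors N" using dvd_prime_factors assms by blast
    show "\<forall>q\<in>prime_factors N - prime_factors n. q ^ multiplicity q n = 1"
    proof
      fix q assume "q \<in> prime_factors N - prime_factors n"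
      then have "multiplicity q n = 0" by (auto simp: prime_factors_multiplicity)
      then show "q ^ multiplicity q n = 1" by simp
    qed
  qed simp
  then show ?thesis using prime_factorization_nat[OF n] by simp
qed

context aut_action begin

text \<open>Prime by prime: with \<open>S q\<close> an invariant Sylow \<open>q\<close>-subgroup,
  \<open>|C(x)|\<close> is at most the product of the fixed point numbers on the \<open>S q\<close>, while for
  the fixed points of all of \<open>P\<close> only the opposite inequality is needed, which holds as coprime
  divisors multiply.\<close>
theorem coprime_action_bound:
  assumes p: "Factorial_Ring.prime p" and cP: "card (carrier P) = p ^ k"
    and fin: "finite (carrier G)" and nd: "\<not> p dvd card (carrier G)"
  shows "fix_bound p \<phi> (carrier P) (carrier G)"
proof -
  let ?N = "card (carrier G)" and ?m = "card (carrier P)"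
  let ?PF = "prime_factors ?N"
  have N0: "?N > 0" using fin one_closed by (metis card_gt_0_iff empty_iff)
  have stG: "stable \<phi> (carrier P) (carrier G)" using act_closed by (auto simp: stable_def)
  have finP: "finite (carrier P)" by (rule finite_if_card_prime_power[OF p cP])
  have "\<forall>q\<in>?PF. \<exists>S. subgroup S G \<and> S \<subseteq> carrier G \<and> stable \<phi> (carrier P) S \<and> card S = q ^ multiplicity q ?N"
    using stable_sylow_exists[OF p P.subgroup_self cP subgroup_self stG fin nd] by blast
  then obtain S where S: "\<And>q. q \<in> ?PF \<Longrightarrow> subgroup (S q) G \<and> S q \<subseteq> carrier G \<and> stable \<phi> (carrier P) (S q) \<and> card (S q) = q ^ multiplicity q ?N"
    by metis
  have F_dvd: "card (fixed_by \<phi> A (carrier G)) dvd ?N" if "A \<subseteq> carrier P" for A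
    using card_subgroup_dvd[OF subgroup_self subgroup_fixed_by[OF that subgroup_self] _ fin] by (auto simp: fixed_by_def)
  have upper: "card (fixed_by \<phi> {x} (carrier G)) \<le> (\<Prod>q\<in>?PF. card (fixed_by \<phi> {x} (S q)))" if x: "x \<in> carrier P" for x
  proof -
    have xP: "{x} \<subseteq> carrier P" using x by simp
    let ?A = "generate P {x}"
    have A: "subgroup ?A P" by (rule P.generate_is_subgroup[OF xP])
    have AP: "?A \<subseteq> carrier P" using A subgroup.subset by blast
    have "card ?A dvd p ^ k" using P.card_subgroup_dvd[OF P.subgroup_self A AP finP] cP by simp
    then obtain j where j: "card ?A = p ^ j" using p by (auto simp: divides_primepow_nat)
    have st: "stable \<phi> ?A H" if "stable \<phi> (carrier P) H" for H using that AP by (auto simp: stable_def)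
    have "card (fixed_by \<phi> {x} (carrier G)) = (\<Prod>q\<in>?PF. q ^ multiplicity q (card (fixed_by \<phi> {x} (carrier G))))"
      by (rule prod_prime_parts[OF F_dvd[OF xP] N0])
    also have "\<dots> \<le> (\<Prod>q\<in>?PF. card (fixed_by \<phi> {x} (S q)))"
    proof (intro prod_mono conjI)
      fix q assume q: "q \<in> ?PF"
      have qp: "Factorial_Ring.prime q" using q by blast
      show "q ^ multiplicity q (card (fixed_by \<phi> {x} (carrier G))) \<le> card (fixed_by \<phi> {x} (S q))"
        using sylow_part_fixed_le[OF p A j subgroup_self st[OF stG] fin nd qp, of "S q"] S[OF q] st[of "S q"]
          fixed_by_generate[OF xP, of "S q"] fixed_by_generate[OF xP, of "carrier G"] by simp
    qed simp
    finally show ?thesis .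
  qed
  have lower: "(\<Prod>q\<in>?PF. card (fixed_by \<phi> (carrier P) (S q))) \<le> card (fixed_by \<phi> (carrier P) (carrier G))"
  proof -
    let ?d = "card (fixed_by \<phi> (carrier P) (carrier G))"
    have d0: "?d > 0" using F_dvd[OF subset_refl] N0 by (metis dvd_0_left neq0_conv)
    have "(\<Prod>q\<in>?PF. card (fixed_by \<phi> (carrier P) (S q))) \<le> (\<Prod>q\<in>?PF. q ^ multiplicity q ?d)"
    proof (intro prod_mono conjI)
      fix q assume q: "q \<in> ?PF"
      have qp: "Factorial_Ring.prime q" using q by blast
      let ?F = "fixed_by \<phi> (carrier P) (S q)"
      have F: "subgroup ?F G" using subgroup_fixed_by[OF subset_refl] S[OF q] by blast
      have "finite (S q)" using S[OF q] fin finite_subset by blast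
      then have "card ?F dvd card (S q)" using card_subgroup_dvd[of "S q" ?F] F S[OF q] by (auto simp: fixed_by_def)
      then obtain i where i: "card ?F = q ^ i" using S[OF q] qp by (auto simp: divides_primepow_nat)
      have "card ?F dvd ?d"
        using card_subgroup_dvd[OF subgroup_fixed_by[OF subset_refl subgroup_self] F fixed_by_mono] S[OF q] fin
        by (auto simp: fixed_by_def)
      then have "i \<le> multiplicity q ?d" using i d0 qp by (metis multiplicity_geI neq0_conv not_prime_unit)
      then show "card ?F \<le> q ^ multiplicity q ?d" using i power_increasing[OF _ prime_ge_1_nat[OF qp]] by metis
    qed simp
    also have "\<dots> = ?d" using prod_prime_parts[OF F_dvd[OF subset_refl] N0] by simp
    finally show ?thesis .
  qed
  have b: "fix_bound p \<phi> (carrier P) (S q)" if q: "q \<in> ?PF" for q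
  proof (rule p_group_bound[OF p cP])
    show "Factorial_Ring.prime q" using q by blast
    show "p \<noteq> q" using nd q by auto
  qed (use S[OF q] in auto)
  have "(\<Prod>x\<in>carrier P. card (fixed_by \<phi> {x} (carrier G))) ^ p
      \<le> (\<Prod>x\<in>carrier P. \<Prod>q\<in>?PF. card (fixed_by \<phi> {x} (S q))) ^ p"
    by (intro power_mono prod_mono) (use upper in auto)
  also have "\<dots> = (\<Prod>q\<in>?PF. (\<Prod>x\<in>carrier P. card (fixed_by \<phi> {x} (S q))) ^ p)"
    by (subst prod.swap) (simp add: prod_power_distrib)
  also have "\<dots> \<le> (\<Prod>q\<in>?PF. card (S q) ^ ?m * card (fixed_by \<phi> (carrier P) (S q)) ^ ((p - 1) * ?m))"
    by (intro prod_mono) (use b in \<open>auto simp: fix_bound_def\<close>)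
  also have "\<dots> = (\<Prod>q\<in>?PF. card (S q)) ^ ?m * (\<Prod>q\<in>?PF. card (fixed_by \<phi> (carrier P) (S q))) ^ ((p - 1) * ?m)"
    by (simp add: prod.distrib prod_power_distrib)
  also have "(\<Prod>q\<in>?PF. card (S q)) = ?N"
    using prime_factorization_nat[OF N0] S by simp
  also have "?N ^ ?m * (\<Prod>q\<in>?PF. card (fixed_by \<phi> (carrier P) (S q))) ^ ((p - 1) * ?m)
     \<le> ?N ^ ?m * card (fixed_by \<phi> (carrier P) (carrier G)) ^ ((p - 1) * ?m)"
    by (intro mult_left_mono power_mono lower) auto
  finally show ?thesis by (simp add: fix_bound_def)
qed

end

section \<open>Centralizers modulo a normal subgroup\<close>

context group begin

lemma subgroup_set_mult_normal:
  assumes "L \<lhd> G" "subgroup Q G"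
  shows "subgroup (Q <#> L) G"
  using mult_norm_subgroup[OF assms] commut_normal[OF assms(2,1)] by simp

lemma subset_set_mult:
  assumes "subgroup L G" "subgroup Q G"
  shows "Q \<subseteq> Q <#> L" "L \<subseteq> Q <#> L"
proof -
  show "Q \<subseteq> Q <#> L"
  proof
    fix q assume q: "q \<in> Q"
    then have "q = q \<otimes> \<one>" using assms subgroup.mem_carrier by fastforce
    then show "q \<in> Q <#> L" using q subgroup.one_closed[OF assms(1)] unfolding set_mult_def by blast
  qed
  show "L \<subseteq> Q <#> L"
  proof
    fix q assume q: "q \<in> L"
    then have "q = \<one> \<otimes> q" using assms subgroup.mem_carrier by fastforce
    then show "q \<in> Q <#> L" using q subgroup.one_closed[OF assms(2)] unfolding set_mult_def by blast
  qed
qed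

lemma set_mult_least:
  "subgroup H G \<Longrightarrow> Q \<subseteq> H \<Longrightarrow> L \<subseteq> H \<Longrightarrow> Q <#> L \<subseteq> H"
  by (auto simp: set_mult_def subgroup.m_closed subset_iff)

lemma conj_set_set_mult:
  assumes L: "L \<lhd> G" and g: "g \<in> carrier G" and Q: "Q \<subseteq> carrier G"
  shows "conj_set G g (Q <#> L) = conj_set G g Q <#> L"
proof -
  interpret L: normal L G by (rule L)
  show ?thesis
  proof
    show "conj_set G g (Q <#> L) \<subseteq> conj_set G g Q <#> L"
    proof
      fix x assume "x \<in> conj_set G g (Q <#> L)"
      then obtain q l where ql: "q \<in> Q" "l \<in> L" "x = g \<otimes> (q \<otimes> l) \<otimes> inv g"
        by (auto simp: conj_set_def set_mult_def)
      then have "x = (g \<otimes> q \<otimes> inv g) \<otimes> (g \<otimes> l \<otimes> inv g)" using conj_mult g Q by auto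
      moreover have "g \<otimes> l \<otimes> inv g \<in> L" using L.inv_op_closed2 g ql by blast
      ultimately show "x \<in> conj_set G g Q <#> L" using ql(1) by (auto simp: conj_set_def set_mult_def)
    qed
    show "conj_set G g Q <#> L \<subseteq> conj_set G g (Q <#> L)"
    proof
      fix x assume "x \<in> conj_set G g Q <#> L"
      then obtain q l where ql: "q \<in> Q" "l \<in> L" "x = (g \<otimes> q \<otimes> inv g) \<otimes> l"
        by (auto simp: conj_set_def set_mult_def)
      have qG: "q \<in> carrier G" using ql Q by blast
      have "x = g \<otimes> (q \<otimes> (inv g \<otimes> l \<otimes> g)) \<otimes> inv g"
        using ql g qG by (simp add: m_assoc)
      moreover have "inv g \<otimes> l \<otimes> g \<in> L" using L.inv_op_closed1 g ql by blast
      ultimately show "x \<in> conj_set G g (Q <#> L)" using ql(1) by (auto simp: conj_set_def set_mult_def)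
    qed
  qed
qed

text \<open>The common factor \<open>e\<close> is the number of cosets of \<open>L\<close> that meet
  \<open>Q\<close>.\<close>
lemma card_set_mult_normal:
  assumes L: "L \<lhd> G" and Q: "subgroup Q G" and fin: "finite (carrier G)"
  shows "\<exists>e. card Q = card (Q \<inter> L) * e \<and> card (Q <#> L) = card L * e"
proof -
  interpret L: normal L G by (rule L)
  interpret Q: subgroup Q G by (rule Q)
  have T: "subgroup (Q <#> L) G" by (rule subgroup_set_mult_normal[OF L Q])
  have TG: "Q <#> L \<subseteq> carrier G" using subgroup.subset[OF T] .
  let ?f = "\<lambda>q. L #> q"
  have 1: "card Q = card (Q \<inter> L) * card (?f ` Q)"
  proof (rule card_eq_card_fibre_mult[OF Q])
    show "finite Q" using fin Q.subset finite_subset by blast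
    fix a b assume "a \<in> Q" "b \<in> Q"
    then show "?f a = ?f b \<longleftrightarrow> inv a \<otimes> b \<in> Q \<inter> L" using normal_rcoset_eq_iff[OF L] by simp
  qed blast
  have 2: "card (Q <#> L) = card L * card (?f ` (Q <#> L))"
  proof (rule card_eq_card_fibre_mult[OF T])
    show "finite (Q <#> L)" using fin TG finite_subset by blast
    show "L \<subseteq> Q <#> L" using subset_set_mult L.subgroup_axioms Q by blast
    fix a b assume "a \<in> Q <#> L" "b \<in> Q <#> L"
    then show "?f a = ?f b \<longleftrightarrow> inv a \<otimes> b \<in> L" using normal_rcoset_eq_iff[OF L] TG by blast
  qed
  have "?f ` (Q <#> L) = ?f ` Q"
  proof
    show "?f ` Q \<subseteq> ?f ` (Q <#> L)" using subset_set_mult(1)[OF L.subgroup_axioms Q] by blast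
    have "L #> (q \<otimes> l) = L #> q" if "q \<in> Q" "l \<in> L" for q l
    proof -
      have "inv q \<otimes> (q \<otimes> l) = l" using that by (simp add: inv_mult_cancel_left)
      then show ?thesis using normal_rcoset_eq_iff[OF L, of q "q \<otimes> l"] that by simp
    qed
    then show "?f ` (Q <#> L) \<subseteq> ?f ` Q" by (auto simp: set_mult_def)
  qed
  then show ?thesis using 1 2 by auto
qed

text \<open>The preimage in \<open>K\<close> of the centralizer of \<open>S\<close> in
  \<open>K/L\<close>.\<close>
definition centralizer_mod :: "'a set \<Rightarrow> 'a set \<Rightarrow> 'a set \<Rightarrow> 'a set" where
  "centralizer_mod L K S = {k \<in> K. \<forall>q\<in>S. q \<otimes> k \<otimes> inv q \<otimes> inv k \<in> L}"

lemma commutator_conj: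
  assumes "g \<in> carrier G" "q \<in> carrier G" "k \<in> carrier G"
  shows "(g \<otimes> q \<otimes> inv g) \<otimes> (g \<otimes> k \<otimes> inv g) \<otimes> inv (g \<otimes> q \<otimes> inv g) \<otimes> inv (g \<otimes> k \<otimes> inv g)
    = g \<otimes> (q \<otimes> k \<otimes> inv q \<otimes> inv k) \<otimes> inv g"
  using assms by (simp add: m_assoc inv_mult_group inv_mult_cancel_left)

lemma card_centralizer_mod_conj:
  assumes L: "L \<lhd> G" and K: "K \<lhd> G" and g: "g \<in> carrier G" and S: "S \<subseteq> carrier G"
  shows "card (centralizer_mod L K (conj_set G g S)) = card (centralizer_mod L K S)"
proof -
  interpret L: normal L G by (rule L)
  interpret K: normal K G by (rule K)
  have iff: "g \<otimes> x \<otimes> inv g \<in> L \<longleftrightarrow> x \<in> L" if "x \<in> carrier G" for x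
  proof
    assume "g \<otimes> x \<otimes> inv g \<in> L"
    then have "inv g \<otimes> (g \<otimes> x \<otimes> inv g) \<otimes> g \<in> L" using L.inv_op_closed1 g by blast
    then show "x \<in> L" using g that by (simp add: m_assoc inv_mult_cancel_left)
  qed (use L.inv_op_closed2 g in blast)
  have "centralizer_mod L K (conj_set G g S) = conj_set G g (centralizer_mod L K S)"
  proof
    show "conj_set G g (centralizer_mod L K S) \<subseteq> centralizer_mod L K (conj_set G g S)"
    proof
      fix y assume "y \<in> conj_set G g (centralizer_mod L K S)"
      then obtain k where k: "k \<in> K" "\<And>q. q \<in> S \<Longrightarrow> q \<otimes> k \<otimes> inv q \<otimes> inv k \<in> L" "y = g \<otimes> k \<otimes> inv g"
        by (auto simp: centralizer_mod_def conj_set_def)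
      have "r \<otimes> y \<otimes> inv r \<otimes> inv y \<in> L" if r: "r \<in> conj_set G g S" for r
      proof -
        obtain q where q: "q \<in> S" "r = g \<otimes> q \<otimes> inv g" using r unfolding conj_set_def by blast
        then show ?thesis using commutator_conj[of g q k] k q g S L.inv_op_closed2[OF g k(2)[OF q(1)]] by auto
      qed
      moreover have "y \<in> K" using k K.inv_op_closed2[OF g k(1)] by simp
      ultimately show "y \<in> centralizer_mod L K (conj_set G g S)" by (simp add: centralizer_mod_def)
    qed
    show "centralizer_mod L K (conj_set G g S) \<subseteq> conj_set G g (centralizer_mod L K S)"
    proof
      fix y assume y: "y \<in> centralizer_mod L K (conj_set G g S)"
      define k where "k = inv g \<otimes> y \<otimes> g"
      have yK: "y \<in> K" using y by (simp add: centralizer_mod_def)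
      have kK: "k \<in> K" using K.inv_op_closed1[OF g yK] by (simp add: k_def)
      have yk: "y = g \<otimes> k \<otimes> inv g" using g yK by (simp add: k_def m_assoc inv_mult_cancel_left)
      have "q \<otimes> k \<otimes> inv q \<otimes> inv k \<in> L" if q: "q \<in> S" for q
      proof -
        have qG: "q \<in> carrier G" using q S by blast
        have "g \<otimes> q \<otimes> inv g \<in> conj_set G g S" using q by (auto simp: conj_set_def)
        then have "(g \<otimes> q \<otimes> inv g) \<otimes> y \<otimes> inv (g \<otimes> q \<otimes> inv g) \<otimes> inv y \<in> L"
          using y by (simp add: centralizer_mod_def)
        then have "g \<otimes> (q \<otimes> k \<otimes> inv q \<otimes> inv k) \<otimes> inv g \<in> L"
          unfolding yk using commutator_conj[OF g qG, of k] kK by simp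
        then show ?thesis using iff qG kK by simp
      qed
      then have "k \<in> centralizer_mod L K S" using kK by (simp add: centralizer_mod_def)
      then show "y \<in> conj_set G g (centralizer_mod L K S)" using yk by (auto simp: conj_set_def)
    qed
  qed
  moreover have "centralizer_mod L K S \<subseteq> carrier G" by (auto simp: centralizer_mod_def)
  ultimately show ?thesis using card_conj_set g by simp
qed

lemma subgroup_centralizer_mod:
  assumes L: "L \<lhd> G" and K: "K \<lhd> G" and S: "S \<subseteq> carrier G"
  shows "subgroup (centralizer_mod L K S) G"
proof -
  interpret L: normal L G by (rule L)
  interpret K: normal K G by (rule K)
  show ?thesis
  proof (rule subgroupI)
    have "q \<otimes> \<one> \<otimes> inv q \<otimes> inv \<one> \<in> L" if "q \<in> S" for q using that S by auto
    then have "\<one> \<in> centralizer_mod L K S" by (simp add: centralizer_mod_def)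
    then show "centralizer_mod L K S \<noteq> {}" by blast
    fix a assume a: "a \<in> centralizer_mod L K S"
    then have aK: "a \<in> K" by (simp add: centralizer_mod_def)
    have "q \<otimes> inv a \<otimes> inv q \<otimes> inv (inv a) \<in> L" if q: "q \<in> S" for q
    proof -
      have qG: "q \<in> carrier G" using q S by blast
      have "q \<otimes> a \<otimes> inv q \<otimes> inv a \<in> L" using a q by (simp add: centralizer_mod_def)
      then have "inv a \<otimes> inv (q \<otimes> a \<otimes> inv q \<otimes> inv a) \<otimes> a \<in> L"
        by (intro L.inv_op_closed1 L.m_inv_closed K.mem_carrier aK)
      then show ?thesis using aK qG by (simp add: m_assoc inv_mult_group inv_mult_cancel_left)
    qed
    then show "inv a \<in> centralizer_mod L K S" using aK by (simp add: centralizer_mod_def)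
    fix b assume b: "b \<in> centralizer_mod L K S"
    then have bK: "b \<in> K" by (simp add: centralizer_mod_def)
    have "q \<otimes> (a \<otimes> b) \<otimes> inv q \<otimes> inv (a \<otimes> b) \<in> L" if q: "q \<in> S" for q
    proof -
      have qG: "q \<in> carrier G" using q S by blast
      have 1: "q \<otimes> a \<otimes> inv q \<otimes> inv a \<in> L" using a q by (simp add: centralizer_mod_def)
      have "q \<otimes> b \<otimes> inv q \<otimes> inv b \<in> L" using b q by (simp add: centralizer_mod_def)
      then have "a \<otimes> (q \<otimes> b \<otimes> inv q \<otimes> inv b) \<otimes> inv a \<in> L"
        by (intro L.inv_op_closed2 K.mem_carrier aK)
      with 1 have "(q \<otimes> a \<otimes> inv q \<otimes> inv a) \<otimes> (a \<otimes> (q \<otimes> b \<otimes> inv q \<otimes> inv b) \<otimes> inv a) \<in> L" by (rule L.m_closed)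
      then show ?thesis using aK bK qG by (simp add: m_assoc inv_mult_group inv_mult_cancel_left)
    qed
    then show "a \<otimes> b \<in> centralizer_mod L K S" using aK bK by (simp add: centralizer_mod_def)
  qed (auto simp: centralizer_mod_def)
qed

lemma conj_action:
  assumes K: "K \<lhd> G" and P: "subgroup P G"
  shows "aut_action (G\<lparr>carrier := K\<rparr>) (G\<lparr>carrier := P\<rparr>) (\<lambda>x k. x \<otimes> k \<otimes> inv x)"
proof -
  interpret K: normal K G by (rule K)
  interpret P: subgroup P G by (rule P)
  interpret KG: group "G\<lparr>carrier := K\<rparr>" by (rule subgroup_imp_group[OF K.subgroup_axioms])
  interpret PG: group "G\<lparr>carrier := P\<rparr>" by (rule subgroup_imp_group[OF P])
  show ?thesis
    by unfold_locales (auto simp: K.inv_op_closed2 conj_mult conj_conj)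
qed

lemma card_centralizer_mod:
  assumes L: "L \<lhd> G" and K: "K \<lhd> G" and LK: "L \<subseteq> K" and fin: "finite (carrier G)"
    and P: "subgroup P G" and S: "S \<subseteq> P"
  shows "card (centralizer_mod L K S) =
    card L * card (fixed_by (\<lambda>x C. (\<lambda>k. x \<otimes> k \<otimes> inv x) ` C) S (carrier (G\<lparr>carrier := K\<rparr> Mod L)))"
proof -
  interpret L: normal L G by (rule L)
  interpret K: normal K G by (rule K)
  interpret P: subgroup P G by (rule P)
  let ?\<phi> = "\<lambda>x k. x \<otimes> k \<otimes> inv x"
  interpret A: aut_action "G\<lparr>carrier := K\<rparr>" "G\<lparr>carrier := P\<rparr>" ?\<phi> by (rule conj_action[OF K P])
  have LsK: "subgroup L (G\<lparr>carrier := K\<rparr>)" using subgroup_incl[OF L.subgroup_axioms K.subgroup_axioms LK] .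
  have stL: "stable ?\<phi> (carrier (G\<lparr>carrier := P\<rparr>)) L" by (auto simp: stable_def L.inv_op_closed2)
  have SG: "S \<subseteq> carrier G" using S by auto
  have fixed: "?\<phi> x ` (L #> k) = L #> k \<longleftrightarrow> x \<otimes> k \<otimes> inv x \<otimes> inv k \<in> L" if "x \<in> P" "k \<in> K" for x k
    using A.act_rcoset[OF LsK stL, of x k] rcoset_eq_iff[OF L.subgroup_axioms, of "x \<otimes> k \<otimes> inv x" k] that by simp
  have LC: "L \<subseteq> centralizer_mod L K S"
    using LK SG by (auto simp: centralizer_mod_def L.inv_op_closed2 subset_iff)
  have "card (centralizer_mod L K S) = card L * card ((\<lambda>k. L #> k) ` centralizer_mod L K S)"
  proof (rule card_eq_card_fibre_mult[OF subgroup_centralizer_mod[OF L K SG] _ LC])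
    show "finite (centralizer_mod L K S)"
      using fin subgroup.subset[OF subgroup_centralizer_mod[OF L K SG]] finite_subset by blast
    fix a b assume "a \<in> centralizer_mod L K S" "b \<in> centralizer_mod L K S"
    then show "L #> a = L #> b \<longleftrightarrow> inv a \<otimes> b \<in> L"
      by (intro normal_rcoset_eq_iff[OF L]) (auto simp: centralizer_mod_def)
  qed
  also have "(\<lambda>k. L #> k) ` centralizer_mod L K S = fixed_by (\<lambda>x C. ?\<phi> x ` C) S (carrier (G\<lparr>carrier := K\<rparr> Mod L))"
  proof (intro equalityI subsetI)
    fix C assume "C \<in> (\<lambda>k. L #> k) ` centralizer_mod L K S"
    then obtain k where k: "k \<in> K" "\<forall>x\<in>S. x \<otimes> k \<otimes> inv x \<otimes> inv k \<in> L" "C = L #> k"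
      unfolding centralizer_mod_def by blast
    have "?\<phi> x ` C = C" if x: "x \<in> S" for x
      unfolding k(3) using fixed[OF subsetD[OF S x] k(1)] k(2) x by simp
    then show "C \<in> fixed_by (\<lambda>x C. ?\<phi> x ` C) S (carrier (G\<lparr>carrier := K\<rparr> Mod L))"
      using k(1,3) unfolding fixed_by_def carrier_FactGroup by simp
  next
    fix C assume "C \<in> fixed_by (\<lambda>x C. ?\<phi> x ` C) S (carrier (G\<lparr>carrier := K\<rparr> Mod L))"
    then have C: "C \<in> (\<lambda>k. L #> k) ` K" "\<forall>x\<in>S. ?\<phi> x ` C = C"
      unfolding fixed_by_def carrier_FactGroup by simp_all
    from C(1) obtain k where k: "k \<in> K" "C = L #> k" by (elim imageE)
    have "x \<otimes> k \<otimes> inv x \<otimes> inv k \<in> L" if x: "x \<in> S" for x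
    proof -
      have "?\<phi> x ` (L #> k) = L #> k" using C(2) x unfolding k(2) by (rule bspec)
      then show ?thesis using fixed[OF subsetD[OF S x] k(1)] by (rule iffD1[rotated])
    qed
    then have "k \<in> centralizer_mod L K S" using k(1) unfolding centralizer_mod_def by simp
    then show "C \<in> (\<lambda>k. L #> k) ` centralizer_mod L K S" using k(2) by (rule rev_image_eqI)
  qed
  finally show ?thesis .
qed

end

section \<open>Sylow subgroups modulo the terms of a normal series\<close>

locale finite_group_with_prime = group G for G (structure) +
  fixes p :: nat
  assumes prime_p: "Factorial_Ring.prime p" and finite_G: "finite (carrier G)"
begin

abbreviation "Syl \<equiv> sylow_subgroups p G"

lemma sylow_iff:
  "Q \<in> Syl \<longleftrightarrow> subgroup Q G \<and> card Q = p ^ multiplicity p (card (carrier G))"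
  by (simp add: sylow_subgroups_def order_def)

lemma subgroup_finite: "subgroup H G \<Longrightarrow> finite H"
  using finite_G subgroup.subset finite_subset by metis

lemma card_subgroup_pos: "subgroup H G \<Longrightarrow> card H > 0"
  using subgroup_finite subgroup.one_closed card_gt_0_iff by blast

lemma card_carrier_pos: "card (carrier G) > 0"
  using card_subgroup_pos[OF subgroup_self] .

lemma sylow_subset: "Q \<in> Syl \<Longrightarrow> Q \<subseteq> carrier G"
  unfolding sylow_iff using subgroup.subset by blast

lemma finite_Syl: "finite Syl"
proof (rule finite_subset)
  show "Syl \<subseteq> Pow (carrier G)" using sylow_subset by blast
qed (use finite_G in simp)

lemma conj_sylow: "Q \<in> Syl \<Longrightarrow> g \<in> carrier G \<Longrightarrow> conj_set G g Q \<in> Syl"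
  by (simp add: sylow_iff subgroup_conj_set card_conj_set subgroup.subset)

lemma card_sylow_in:
  assumes Q: "Q \<in> Syl" and H: "subgroup H G" "Q \<subseteq> H"
  shows "card Q = p ^ multiplicity p (card H)"
proof -
  let ?a = "multiplicity p (card (carrier G))"
  have Q': "subgroup Q G" "card Q = p ^ ?a" using Q by (auto simp: sylow_iff)
  have "card Q dvd card H" using card_subgroup_dvd[OF H(1) Q'(1) H(2)] subgroup_finite[OF H(1)] by blast
  then have "?a \<le> multiplicity p (card H)" using Q'(2) card_subgroup_pos[OF H(1)] prime_p
    by (metis multiplicity_geI neq0_conv not_prime_unit)
  moreover have "card H dvd card (carrier G)"
    using card_subgroup_dvd[OF subgroup_self H(1) subgroup.subset[OF H(1)] finite_G] .
  then have "multiplicity p (card H) \<le> ?a"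
    using card_carrier_pos by (intro dvd_imp_multiplicity_le) auto
  ultimately show ?thesis using Q'(2) by simp
qed

lemma p_subgroup_conj_into:
  assumes "Q \<in> Syl" "subgroup H G" "Q \<subseteq> H" "subgroup R G" "R \<subseteq> H" "card R = p ^ k"
  shows "\<exists>h\<in>H. conj_set G h R \<subseteq> Q"
  using p_subgroup_conj_into_sylow[OF prime_p subgroup_finite[OF assms(2)] assms(2) _ assms(3) _ assms(4-6)]
    card_sylow_in[OF assms(1-3)] assms(1) by (simp add: sylow_iff)

lemma sylow_conj_in:
  assumes "Q \<in> Syl" "subgroup H G" "Q \<subseteq> H" "R \<in> Syl" "R \<subseteq> H"
  shows "\<exists>h\<in>H. conj_set G h R = Q"
proof -
  have R: "subgroup R G" "card R = p ^ multiplicity p (card (carrier G))" using assms(4) by (auto simp: sylow_iff)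
  obtain h where h: "h \<in> H" "conj_set G h R \<subseteq> Q"
    using p_subgroup_conj_into[OF assms(1-3) R(1) assms(5) R(2)] by blast
  have hG: "h \<in> carrier G" using h(1) subgroup.subset[OF assms(2)] by blast
  have "card (conj_set G h R) = card Q"
    using conj_sylow[OF assms(4) hG] assms(1) by (simp add: sylow_iff)
  then have "conj_set G h R = Q"
    using h(2) subgroup_finite assms(1) by (metis card_subset_eq sylow_iff)
  then show ?thesis using h(1) by blast
qed

lemma sylow_containing:
  assumes Q: "Q \<in> Syl" and H: "subgroup H G" "Q \<subseteq> H" and x: "x \<in> H" "ord x = p ^ k"
  shows "\<exists>t\<in>H. x \<in> conj_set G t Q"
proof -
  have xG: "x \<in> carrier G" using x H subgroup.subset by blast
  have R: "subgroup (generate G {x}) G" using generate_is_subgroup xG by simp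
  have RH: "generate G {x} \<subseteq> H" using generate_subgroup_incl[OF _ H(1)] x(1) by simp
  obtain h where h: "h \<in> H" "conj_set G h (generate G {x}) \<subseteq> Q"
    using p_subgroup_conj_into[OF Q H R RH, of k] generate_pow_card[OF xG, symmetric] x(2) by auto
  have hG: "h \<in> carrier G" using h(1) subgroup.subset[OF H(1)] by blast
  have "h \<otimes> x \<otimes> inv h \<in> Q" using h(2) generate.incl[of x "{x}" G] by (auto simp: conj_set_def)
  then have "inv h \<otimes> (h \<otimes> x \<otimes> inv h) \<otimes> inv (inv h) \<in> conj_set G (inv h) Q" unfolding conj_set_def by (rule imageI)
  then have "x \<in> conj_set G (inv h) Q" using hG xG by (simp add: m_assoc inv_mult_cancel_left)
  then show ?thesis using subgroup.m_inv_closed[OF H(1) h(1)] by blast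
qed

text \<open>The overgroups \<open>QK\<close> correspond to the Sylow subgroups of \<open>G/K\<close>. They are
  used in place of \<open>G/K\<close> so that all terms of a normal series can be compared inside
  \<open>G\<close>.\<close>
definition cover :: "'a set \<Rightarrow> 'a set set" where
  "cover K = (\<lambda>Q. Q <#> K) ` Syl"

definition covers_of :: "'a set \<Rightarrow> 'a \<Rightarrow> nat" where
  "covers_of K x = card {T \<in> cover K. x \<in> T}"

lemma sylow_mult_mult:
  assumes L: "L \<lhd> G" and K: "K \<lhd> G" and LK: "L \<subseteq> K" and Q: "Q \<in> Syl"
  shows "(Q <#> L) <#> K = Q <#> K"
proof -
  have sL: "subgroup L G" and sK: "subgroup K G" using L K normal_imp_subgroup by auto
  have "L <#> K = K"
    using set_mult_least[OF sK LK subset_refl] subset_set_mult(2)[OF sK sL] by blast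
  then show ?thesis using set_mult_assoc[of Q L K] Q sL sK subgroup.subset by (metis sylow_iff)
qed

text \<open>The index of \<open>QL\<close> in \<open>QK\<close> divides the \<open>p\<close>-power
  \<open>|K/L|\<close>, but it is prime to \<open>p\<close> because \<open>QL\<close> contains a Sylow
  subgroup of \<open>G\<close>.\<close>
lemma p_factor_cover:
  assumes L: "L \<lhd> G" and K: "K \<lhd> G" and LK: "L \<subseteq> K" and c: "card K = card L * p ^ e"
  shows "cover L = cover K"
proof -
  have sL: "subgroup L G" and sK: "subgroup K G" using L K normal_imp_subgroup by auto
  have "Q <#> L = Q <#> K" if Q: "Q \<in> Syl" for Q
  proof -
    let ?T = "Q <#> L"
    have sQ: "subgroup Q G" using Q by (simp add: sylow_iff)
    have T: "subgroup ?T G" by (rule subgroup_set_mult_normal[OF L sQ])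
    have TK: "subgroup (?T <#> K) G" by (rule subgroup_set_mult_normal[OF K T])
    have sub: "?T \<subseteq> ?T <#> K" by (rule subset_set_mult(1)[OF sK T])
    have TiK: "subgroup (?T \<inter> K) G" by (rule subgroups_Inter_pair[OF T sK])
    obtain u where u: "card ?T = card (?T \<inter> K) * u" "card (?T <#> K) = card K * u"
      using card_set_mult_normal[OF K T finite_G] by blast
    have "L \<subseteq> ?T \<inter> K" using LK subset_set_mult(2)[OF sL sQ] by blast
    then have "card L dvd card (?T \<inter> K)"
      using card_subgroup_dvd[OF TiK sL] subgroup_finite[OF TiK] by blast
    then obtain t where t: "card (?T \<inter> K) = card L * t" by (rule dvdE)
    have "card (?T \<inter> K) dvd card K"
      using card_subgroup_dvd[OF sK TiK] subgroup_finite[OF sK] by blast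
    then obtain s where s: "card K = card (?T \<inter> K) * s" by (rule dvdE)
    have "card L * p ^ e = card L * (t * s)" using c s t by (metis mult.assoc)
    then have "s dvd p ^ e" using card_subgroup_pos[OF sL] by simp
    moreover have TKs: "card (?T <#> K) = card ?T * s" using u s by simp
    have "\<not> p dvd s"
    proof
      assume "p dvd s"
      then have "p * card Q dvd card (?T <#> K)"
        using TKs card_subgroup_dvd[OF T sQ subset_set_mult(1)[OF sL sQ] subgroup_finite[OF T]]
        by (metis mult.commute mult_dvd_mono)
      moreover have "card (?T <#> K) dvd card (carrier G)"
        using card_subgroup_dvd[OF subgroup_self TK subgroup.subset[OF TK] finite_G] .
      ultimately have "p * card Q dvd card (carrier G)" by (rule dvd_trans)
      then have "p ^ Suc (multiplicity p (card (carrier G))) dvd card (carrier G)"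
        using Q by (simp add: sylow_iff)
      then show False using card_carrier_pos prime_p
        by (metis multiplicity_geI neq0_conv not_less_eq_eq not_prime_unit order_refl)
    qed
    ultimately have "s = 1" using dvd_prime_power_cases[OF prime_p] by blast
    then have "?T = ?T <#> K" using TKs sub subgroup_finite[OF TK] by (simp add: card_subset_eq)
    then show ?thesis using sylow_mult_mult[OF L K LK Q] by simp
  qed
  then show ?thesis unfolding cover_def by (intro image_cong refl)
qed

text \<open>Modulo \<open>L\<close> the intersection lies in a \<open>p\<close>-group and in a
  \<open>p'\<close>-group.\<close>
lemma p'_factor_inter:
  assumes L: "L \<lhd> G" and K: "K \<lhd> G" and LK: "L \<subseteq> K"
    and c: "card K = card L * m" "coprime p m" and Q: "Q \<in> Syl"
  shows "(Q <#> L) \<inter> K = L"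
proof -
  have sL: "subgroup L G" and sK: "subgroup K G" using L K normal_imp_subgroup by auto
  let ?T = "Q <#> L"
  have sQ: "subgroup Q G" using Q by (simp add: sylow_iff)
  have T: "subgroup ?T G" by (rule subgroup_set_mult_normal[OF L sQ])
  have TiK: "subgroup (?T \<inter> K) G" by (rule subgroups_Inter_pair[OF T sK])
  have LT: "L \<subseteq> ?T \<inter> K" using LK subset_set_mult(2)[OF sL sQ] by blast
  obtain e where e: "card Q = card (Q \<inter> L) * e" "card ?T = card L * e"
    using card_set_mult_normal[OF L sQ finite_G] by blast
  have "card L dvd card (?T \<inter> K)"
    using card_subgroup_dvd[OF TiK sL LT] subgroup_finite[OF TiK] by blast
  then obtain t where t: "card (?T \<inter> K) = card L * t" by (rule dvdE)
  have "card (?T \<inter> K) dvd card K"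
    using card_subgroup_dvd[OF sK TiK] subgroup_finite[OF sK] by blast
  then obtain s where s: "card K = card (?T \<inter> K) * s" by (rule dvdE)
  have "card (?T \<inter> K) dvd card ?T"
    using card_subgroup_dvd[OF T TiK] subgroup_finite[OF T] by blast
  then obtain r where r: "card ?T = card (?T \<inter> K) * r" by (rule dvdE)
  have "card L * m = card L * (t * s)" using c(1) s t by (metis mult.assoc)
  then have tm: "t dvd m" using card_subgroup_pos[OF sL] by simp
  have "card L * e = card L * (t * r)" using e(2) r t by (metis mult.assoc)
  then have "t dvd e" using card_subgroup_pos[OF sL] by simp
  then have "t dvd card Q" using e by simp
  then have "t dvd p ^ multiplicity p (card (carrier G))" using Q by (simp add: sylow_iff)
  then consider "t = 1" | "p dvd t" using dvd_prime_power_cases[OF prime_p] by blast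
  then have "t = 1"
  proof cases
    case 2
    then have "p dvd m" using tm dvd_trans by blast
    then show ?thesis using c(2) prime_p by (metis coprime_absorb_left not_prime_unit)
  qed
  then show ?thesis using t LT subgroup_finite[OF TiK] by (metis card_subset_eq mult.right_neutral)
qed

text \<open>Choose a Sylow subgroup \<open>Q\<close> of \<open>T\<close> that contains \<open>x\<close>. The
  overgroups in question are the conjugates of \<open>W = QL\<close> by elements of \<open>K\<close>. As
  \<open>W \<inter> K = L\<close>, such a conjugate contains \<open>x\<close> exactly if the conjugating
  element centralizes \<open>x\<close> modulo \<open>L\<close>, and it equals \<open>W\<close> exactly if that
  element centralizes \<open>Q\<close> modulo \<open>L\<close>.\<close>
lemma card_cover_fibre:
  assumes L: "L \<lhd> G" and K: "K \<lhd> G" and LK: "L \<subseteq> K"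
    and c: "card K = card L * m" "coprime p m" and P: "P \<in> Syl"
    and T: "T \<in> cover K" and x: "x \<in> T" "ord x = p ^ k"
  shows "card {S \<in> cover L. S <#> K = T \<and> x \<in> S} * card (centralizer_mod L K P)
    = card (centralizer_mod L K {x})"
proof -
  interpret L: normal L G by (rule L)
  interpret K: normal K G by (rule K)
  have sL: "subgroup L G" and sK: "subgroup K G" using L K normal_imp_subgroup by auto
  obtain Q1 where Q1: "Q1 \<in> Syl" "T = Q1 <#> K" using T by (auto simp: cover_def)
  have sQ1: "subgroup Q1 G" using Q1 by (simp add: sylow_iff)
  have sT: "subgroup T G" using subgroup_set_mult_normal[OF K sQ1] Q1(2) by simp
  have TG: "T \<subseteq> carrier G" using subgroup.subset[OF sT] .
  have QT: "Q1 \<subseteq> T" and KT: "K \<subseteq> T" using subset_set_mult[OF sK sQ1] Q1(2) by auto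
  have conjT: "conj_set G t T = T" if "t \<in> T" for t
    using conj_set_self[OF sT that subgroup_finite[OF sT]] .
  have sylT: "R <#> K = T" if R: "R \<in> Syl" "R \<subseteq> T" for R
  proof -
    obtain t where t: "t \<in> T" "conj_set G t Q1 = R" using sylow_conj_in[OF R(1) sT R(2) Q1(1) QT] by blast
    have tG: "t \<in> carrier G" using t(1) TG by blast
    have "R <#> K = conj_set G t T"
      using conj_set_set_mult[OF K tG subgroup.subset[OF sQ1]] t Q1(2) by simp
    then show ?thesis using conjT t(1) by simp
  qed
  obtain t where t: "t \<in> T" "x \<in> conj_set G t Q1" using sylow_containing[OF Q1(1) sT QT x] by blast
  define Q where "Q = conj_set G t Q1"
  have Q: "Q \<in> Syl" using conj_sylow[OF Q1(1)] t(1) TG unfolding Q_def by blast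
  have QsT: "Q \<subseteq> T" unfolding Q_def by (rule conj_set_closed_subgroup[OF sT t(1) QT])
  have xQ: "x \<in> Q" using t(2) by (simp add: Q_def)
  have sQ: "subgroup Q G" using Q by (simp add: sylow_iff)
  have QG: "Q \<subseteq> carrier G" using subgroup.subset[OF sQ] .
  have xG: "x \<in> carrier G" using xQ QG by blast
  define W where "W = Q <#> L"
  have sW: "subgroup W G" using subgroup_set_mult_normal[OF L sQ] by (simp add: W_def)
  interpret W: subgroup W G by (rule sW)
  have QW: "Q \<subseteq> W" and LW: "L \<subseteq> W" using subset_set_mult[OF sL sQ] by (auto simp: W_def)
  have WK: "W \<inter> K = L" unfolding W_def by (rule p'_factor_inter[OF L K LK c Q])
  have finW: "finite W" using subgroup_finite[OF sW] .
  \<comment> \<open>the commutator of \<open>k\<close> and \<open>q\<close> lies in \<open>K\<close>, so it lies in \<open>W\<close> only if it lies in \<open>L\<close>\<close>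
  have comm: "inv k \<otimes> q \<otimes> k \<in> W \<longleftrightarrow> q \<otimes> k \<otimes> inv q \<otimes> inv k \<in> L" if k: "k \<in> K" and q: "q \<in> Q" for k q
  proof -
    have kG: "k \<in> carrier G" and qG: "q \<in> carrier G" and qW: "q \<in> W" using k q QG QW by auto
    let ?z = "inv k \<otimes> q \<otimes> k \<otimes> inv q"
    have zG: "?z \<in> carrier G" using kG qG by simp
    have "inv k \<otimes> q \<otimes> k = ?z \<otimes> q" using kG qG by (simp add: m_assoc)
    then have "inv k \<otimes> q \<otimes> k \<in> W \<longleftrightarrow> ?z \<in> W"
      using qW kG qG zG by (metis W.m_closed W.m_inv_closed inv_solve_right)
    also have "\<dots> \<longleftrightarrow> ?z \<in> L"
    proof -
      have "q \<otimes> k \<otimes> inv q \<in> K" using K.inv_op_closed2[OF qG k] .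
      then have "inv k \<otimes> (q \<otimes> k \<otimes> inv q) \<in> K" using k K.m_closed K.m_inv_closed by blast
      then have "?z \<in> K" using kG qG by (simp add: m_assoc)
      then show ?thesis using WK by blast
    qed
    also have "\<dots> \<longleftrightarrow> q \<otimes> k \<otimes> inv q \<otimes> inv k \<in> L"
    proof
      assume "?z \<in> L"
      then have "k \<otimes> ?z \<otimes> inv k \<in> L" by (rule L.inv_op_closed2[OF kG])
      then show "q \<otimes> k \<otimes> inv q \<otimes> inv k \<in> L" using kG qG by (simp add: m_assoc inv_mult_cancel_left)
    next
      assume "q \<otimes> k \<otimes> inv q \<otimes> inv k \<in> L"
      then have "inv k \<otimes> (q \<otimes> k \<otimes> inv q \<otimes> inv k) \<otimes> k \<in> L" by (rule L.inv_op_closed1[OF kG])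
      then show "?z \<in> L" using kG qG by (simp add: m_assoc inv_mult_cancel_left)
    qed
    finally show ?thesis .
  qed
  have mem_conj: "y \<in> conj_set G k W \<longleftrightarrow> inv k \<otimes> y \<otimes> k \<in> W" if "k \<in> carrier G" "y \<in> carrier G" for k y
  proof
    assume "y \<in> conj_set G k W"
    then obtain w where "w \<in> W" "y = k \<otimes> w \<otimes> inv k" unfolding conj_set_def by blast
    then show "inv k \<otimes> y \<otimes> k \<in> W" using that(1) by (simp add: m_assoc inv_mult_cancel_left)
  next
    assume "inv k \<otimes> y \<otimes> k \<in> W"
    then have "k \<otimes> (inv k \<otimes> y \<otimes> k) \<otimes> inv k \<in> conj_set G k W" unfolding conj_set_def by (rule imageI)
    then show "y \<in> conj_set G k W" using that by (simp add: m_assoc inv_mult_cancel_left)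
  qed
  have stab: "conj_set G k W = W \<longleftrightarrow> k \<in> centralizer_mod L K Q" if k: "k \<in> K" for k
  proof
    assume e: "conj_set G k W = W"
    have "q \<otimes> k \<otimes> inv q \<otimes> inv k \<in> L" if q: "q \<in> Q" for q
    proof -
      have "q \<in> conj_set G k W" unfolding e using q QW by blast
      then have "inv k \<otimes> q \<otimes> k \<in> W"
        using mem_conj[OF K.mem_carrier[OF k] subsetD[OF QG q]] by (rule iffD1[rotated])
      then show ?thesis using comm[OF k q] by (rule iffD1[rotated])
    qed
    then show "k \<in> centralizer_mod L K Q" using k by (simp add: centralizer_mod_def)
  next
    assume kC: "k \<in> centralizer_mod L K Q"
    have kG: "k \<in> carrier G" using k by simp
    have "Q \<subseteq> conj_set G k W"
    proof
      fix q assume q: "q \<in> Q"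
      have "q \<otimes> k \<otimes> inv q \<otimes> inv k \<in> L" using kC q by (simp add: centralizer_mod_def)
      then have "inv k \<otimes> q \<otimes> k \<in> W" using comm[OF k q] by (rule iffD2[rotated])
      then show "q \<in> conj_set G k W" using mem_conj[OF kG subsetD[OF QG q]] by (rule iffD2[rotated])
    qed
    moreover have "L \<subseteq> conj_set G k W"
    proof
      fix l assume l: "l \<in> L"
      then have "inv k \<otimes> l \<otimes> k \<in> W" using L.inv_op_closed1[OF kG l] LW by blast
      then show "l \<in> conj_set G k W"
        using mem_conj[OF kG L.mem_carrier[OF l]] by (rule iffD2[rotated])
    qed
    ultimately have "Q <#> L \<subseteq> conj_set G k W" by (rule set_mult_least[OF subgroup_conj_set[OF kG sW]])
    then have "W \<subseteq> conj_set G k W" by (simp only: W_def)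
    moreover have "finite (conj_set G k W)" using finW by (simp add: conj_set_def)
    ultimately show "conj_set G k W = W"
      using card_conj_set[OF kG W.subset] card_subset_eq[of "conj_set G k W" W] by simp
  qed
  let ?C = "centralizer_mod L K {x}"
  have sC: "subgroup ?C G" using subgroup_centralizer_mod[OF L K] xG by simp
  have CK: "?C \<subseteq> K" by (auto simp: centralizer_mod_def)
  have x_iff: "x \<in> conj_set G k W \<longleftrightarrow> k \<in> ?C" if "k \<in> K" for k
    using mem_conj[of k x] comm[OF that xQ] that xG by (simp add: centralizer_mod_def)
  have img: "(\<lambda>k. conj_set G k W) ` ?C = {S \<in> cover L. S <#> K = T \<and> x \<in> S}"
  proof (intro equalityI subsetI)
    fix S assume "S \<in> (\<lambda>k. conj_set G k W) ` ?C"
    then obtain k where k: "k \<in> ?C" "S = conj_set G k W" by blast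
    then have kK: "k \<in> K" using CK by blast
    then have kG: "k \<in> carrier G" and kT: "k \<in> T" using KT by auto
    have S: "S = conj_set G k Q <#> L" using conj_set_set_mult[OF L kG QG] k(2) by (simp add: W_def)
    have kQ: "conj_set G k Q \<in> Syl" by (rule conj_sylow[OF Q kG])
    have "S <#> K = T"
      unfolding S sylow_mult_mult[OF L K LK kQ]
      by (rule sylT[OF kQ conj_set_closed_subgroup[OF sT kT QsT]])
    moreover have "S \<in> cover L" unfolding cover_def S using kQ by (rule imageI)
    moreover have "x \<in> S" using x_iff[OF kK] k by simp
    ultimately show "S \<in> {S \<in> cover L. S <#> K = T \<and> x \<in> S}" by blast
  next
    fix S assume S: "S \<in> {S \<in> cover L. S <#> K = T \<and> x \<in> S}"
    then have "S \<in> cover L" by blast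
    then obtain R where R: "R \<in> Syl" "S = R <#> L" unfolding cover_def by (elim imageE)
    have sR: "subgroup R G" using R by (simp add: sylow_iff)
    have "R <#> K = T" using S sylow_mult_mult[OF L K LK R(1)] R(2) by simp
    then have RT: "R \<subseteq> T" using subset_set_mult(1)[OF sK sR] by simp
    obtain h where h: "h \<in> T" "conj_set G h Q = R" using sylow_conj_in[OF R(1) sT RT Q QsT] by blast
    have "h \<in> K <#> Q" using h(1) sylT[OF Q QsT] commut_normal[OF sQ K] by simp
    then obtain k q where kq: "k \<in> K" "q \<in> Q" "h = k \<otimes> q" by (auto simp: set_mult_def)
    have kG: "k \<in> carrier G" and qG: "q \<in> carrier G" using kq QG by auto
    have "R = conj_set G k Q"
      using h(2) conj_set_mult[OF kG qG QG] conj_set_self[OF sQ kq(2) subgroup_finite[OF sQ]] kq(3) by simp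
    then have Sk: "S = conj_set G k W" using conj_set_set_mult[OF L kG QG] R(2) by (simp add: W_def)
    then have "k \<in> ?C" using x_iff[OF kq(1)] S by blast
    then show "S \<in> (\<lambda>k. conj_set G k W) ` ?C" using Sk by (rule rev_image_eqI)
  qed
  have "card ?C = card (centralizer_mod L K Q) * card ((\<lambda>k. conj_set G k W) ` ?C)"
  proof (rule card_eq_card_fibre_mult[OF sC subgroup_finite[OF sC]])
    show "centralizer_mod L K Q \<subseteq> ?C" using xQ by (auto simp: centralizer_mod_def)
    fix a b assume ab: "a \<in> ?C" "b \<in> ?C"
    then have G: "a \<in> carrier G" "b \<in> carrier G" and K: "inv a \<otimes> b \<in> K"
      using CK by auto
    show "conj_set G a W = conj_set G b W \<longleftrightarrow> inv a \<otimes> b \<in> centralizer_mod L K Q"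
      using conj_set_eq_iff[OF G W.subset] stab[OF K] by simp
  qed
  moreover have "card (centralizer_mod L K Q) = card (centralizer_mod L K P)"
  proof -
    have PG: "P \<subseteq> carrier G" using P by (rule sylow_subset)
    obtain g where "g \<in> carrier G" "conj_set G g P = Q"
      using sylow_conj_in[OF Q subgroup_self QG P PG] by blast
    then show ?thesis using card_centralizer_mod_conj[OF L K _ PG] by blast
  qed
  ultimately show ?thesis using img by (simp add: mult.commute)
qed

lemma p'_factor_covers:
  assumes L: "L \<lhd> G" and K: "K \<lhd> G" and LK: "L \<subseteq> K"
    and c: "card K = card L * m" "coprime p m" and P: "P \<in> Syl"
    and x: "x \<in> carrier G" "ord x = p ^ k"
  shows "covers_of L x * card (centralizer_mod L K P) = covers_of K x * card (centralizer_mod L K {x})"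
proof -
  have sL: "subgroup L G" and sK: "subgroup K G" using L K normal_imp_subgroup by auto
  let ?A = "{T \<in> cover K. x \<in> T}"
  let ?B = "\<lambda>T. {S \<in> cover L. S <#> K = T \<and> x \<in> S}"
  have fin: "finite (cover L)" "finite (cover K)" using finite_Syl by (auto simp: cover_def)
  have "{S \<in> cover L. x \<in> S} = (\<Union>T\<in>?A. ?B T)"
  proof (intro equalityI subsetI)
    fix S assume S: "S \<in> {S \<in> cover L. x \<in> S}"
    then have "S \<in> cover L" and xS: "x \<in> S" by auto
    then obtain Q where Q: "Q \<in> Syl" "S = Q <#> L" unfolding cover_def by (elim imageE)
    have sS: "subgroup S G" using subgroup_set_mult_normal[OF L] Q by (simp add: sylow_iff)
    have SK: "S <#> K = Q <#> K" using sylow_mult_mult[OF L K LK Q(1)] Q(2) by simp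
    then have "S <#> K \<in> cover K" unfolding cover_def using Q(1) by blast
    moreover have "x \<in> S <#> K" using subset_set_mult(1)[OF sK sS] xS by blast
    ultimately show "S \<in> (\<Union>T\<in>?A. ?B T)" using S by blast
  qed blast
  then have "covers_of L x = card (\<Union>T\<in>?A. ?B T)" by (simp add: covers_of_def)
  also have "\<dots> = (\<Sum>T\<in>?A. card (?B T))" using fin by (intro card_UN_disjoint) auto
  finally have "covers_of L x * card (centralizer_mod L K P) = (\<Sum>T\<in>?A. card (?B T) * card (centralizer_mod L K P))"
    by (simp add: sum_distrib_right)
  also have "\<dots> = (\<Sum>T\<in>?A. card (centralizer_mod L K {x}))"
    using card_cover_fibre[OF L K LK c P _ _ x(2)] by (intro sum.cong) auto
  finally show ?thesis by (simp add: covers_of_def)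
qed

text \<open>For \<open>K = 1\<close> this is the multiplicative form of the theorem; \<open>\<one>\<close>
  lies in every overgroup, so \<open>covers_of K \<one>\<close> counts them all.\<close>
definition covers_bound :: "'a set \<Rightarrow> 'a set \<Rightarrow> bool" where
  "covers_bound P K \<longleftrightarrow> (\<Prod>x\<in>P. covers_of K x) ^ p \<le> covers_of K \<one> ^ card P"

lemma sylow_ord:
  assumes "Q \<in> Syl" "x \<in> Q"
  shows "\<exists>k. ord x = p ^ k"
proof -
  have Q: "subgroup Q G" using assms(1) by (simp add: sylow_iff)
  have xG: "x \<in> carrier G" using assms(2) subgroup.subset[OF Q] by blast
  have "generate G {x} \<subseteq> Q" using generate_subgroup_incl[OF _ Q] assms(2) by simp
  then have "card (generate G {x}) dvd card Q"
    using card_subgroup_dvd[OF Q generate_is_subgroup _ subgroup_finite[OF Q]] xG by simp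
  then have "ord x dvd p ^ multiplicity p (card (carrier G))"
    using generate_pow_card[OF xG] assms(1) by (simp add: sylow_iff)
  then show ?thesis using prime_p by (auto simp: divides_primepow_nat)
qed

text \<open>Both sides change by factors that \<open>coprime_action_bound\<close> compares, applied to the
  conjugation action of \<open>P\<close> on \<open>K/L\<close>. The order of the centralizer of
  \<open>P\<close> enters with exponent \<open>p |P| = |P| + (p - 1) |P|\<close> on both sides and
  cancels.\<close>
lemma p'_factor_bound:
  assumes L: "L \<lhd> G" and K: "K \<lhd> G" and LK: "L \<subseteq> K"
    and c: "card K = card L * m" "coprime p m" and P: "P \<in> Syl" and b: "covers_bound P K"
  shows "covers_bound P L"
proof -
  interpret L: normal L G by (rule L)
  interpret K: normal K G by (rule K)
  have sP: "subgroup P G" and cP: "card P = p ^ multiplicity p (card (carrier G))" using P by (auto simp: sylow_iff)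
  have PG: "P \<subseteq> carrier G" using subgroup.subset[OF sP] .
  have finP: "finite P" using subgroup_finite[OF sP] .
  let ?\<phi> = "\<lambda>x k. x \<otimes> k \<otimes> inv x" and ?KK = "G\<lparr>carrier := K\<rparr>" and ?PP = "G\<lparr>carrier := P\<rparr>"
  let ?\<psi> = "\<lambda>x C. ?\<phi> x ` C" and ?Q = "carrier (G\<lparr>carrier := K\<rparr> Mod L)"
  interpret A: aut_action ?KK ?PP ?\<phi> by (rule conj_action[OF K sP])
  have LsK: "subgroup L ?KK" using subgroup_incl[OF L.subgroup_axioms K.subgroup_axioms LK] .
  have stL: "stable ?\<phi> (carrier ?PP) L" using PG by (auto simp: stable_def L.inv_op_closed2)
  interpret Q: aut_action "?KK Mod L" ?PP ?\<psi>
    by (rule A.aut_action_quotient[OF normal_restrict_supergroup[OF K.subgroup_axioms L LK] stL])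
  have L0: "card L > 0" by (rule card_subgroup_pos[OF L.subgroup_axioms])
  have "card K = card ?Q * card L" using A.lagrange[OF LsK] by (simp add: order_def FactGroup_def)
  then have cQ: "card ?Q = m" using c(1) L0 by (simp add: mult.commute)
  have m0: "m > 0" using c(1) card_subgroup_pos[OF K.subgroup_axioms] by (metis mult_0_right neq0_conv)
  then have finQ: "finite ?Q" using cQ card_gt_0_iff by metis
  have ndQ: "\<not> p dvd card ?Q" using c(2) cQ prime_p by (metis coprime_absorb_left not_prime_unit)
  have "fix_bound p ?\<psi> P ?Q"
    using Q.coprime_action_bound[OF prime_p _ finQ ndQ] cP by simp
  then have fb: "(\<Prod>x\<in>P. card (fixed_by ?\<psi> {x} ?Q)) ^ p \<le> m ^ card P * card (fixed_by ?\<psi> P ?Q) ^ ((p - 1) * card P)"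
    by (simp add: fix_bound_def cQ)
  let ?d = "card (centralizer_mod L K P)"
  have cent: "card (centralizer_mod L K S) = card L * card (fixed_by ?\<psi> S ?Q)" if "S \<subseteq> P" for S
    by (rule card_centralizer_mod[OF L K LK finite_G sP that])
  have d0: "?d > 0" by (rule card_subgroup_pos[OF subgroup_centralizer_mod[OF L K PG]])
  have pw: "p * n = n + (p - 1) * n" for n using prime_gt_0_nat[OF prime_p] by (cases p) auto
  have coprime_part: "(\<Prod>x\<in>P. card (centralizer_mod L K {x})) ^ p \<le> card K ^ card P * ?d ^ ((p - 1) * card P)"
  proof -
    have "(\<Prod>x\<in>P. card (centralizer_mod L K {x})) ^ p = (\<Prod>x\<in>P. card L * card (fixed_by ?\<psi> {x} ?Q)) ^ p"
      using cent by (intro arg_cong[where f = "\<lambda>t. t ^ p"] prod.cong) auto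
    also have "\<dots> = card L ^ (p * card P) * (\<Prod>x\<in>P. card (fixed_by ?\<psi> {x} ?Q)) ^ p"
      by (simp add: prod.distrib power_mult_distrib mult.commute flip: power_mult)
    also have "\<dots> \<le> card L ^ (p * card P) * (m ^ card P * card (fixed_by ?\<psi> P ?Q) ^ ((p - 1) * card P))"
      using fb by (rule mult_left_mono) simp
    also have "\<dots> = card K ^ card P * ?d ^ ((p - 1) * card P)"
      unfolding pw cent[OF subset_refl] c(1) by (simp add: power_add power_mult_distrib)
    finally show ?thesis .
  qed
  have step: "covers_of L x * ?d = covers_of K x * card (centralizer_mod L K {x})" if "x \<in> P" for x
    using p'_factor_covers[OF L K LK c P _] sylow_ord[OF P that] that PG by blast
  have "\<one> \<in> P" using subgroup.one_closed[OF sP] .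
  moreover have "centralizer_mod L K {\<one>} = K" by (auto simp: centralizer_mod_def)
  ultimately have step1: "covers_of L \<one> * ?d = covers_of K \<one> * card K" using step by metis
  have "(\<Prod>x\<in>P. covers_of L x) ^ p * ?d ^ (p * card P) = (\<Prod>x\<in>P. covers_of L x * ?d) ^ p"
    by (simp add: prod.distrib power_mult_distrib mult.commute flip: power_mult)
  also have "\<dots> = (\<Prod>x\<in>P. covers_of K x) ^ p * (\<Prod>x\<in>P. card (centralizer_mod L K {x})) ^ p"
    using step by (simp add: prod.distrib power_mult_distrib)
  also have "\<dots> \<le> covers_of K \<one> ^ card P * (card K ^ card P * ?d ^ ((p - 1) * card P))"
    using b coprime_part unfolding covers_bound_def by (rule mult_le_mono)
  also have "\<dots> = (covers_of L \<one> * ?d) ^ card P * ?d ^ ((p - 1) * card P)"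
    unfolding step1 by (simp add: power_mult_distrib)
  also have "\<dots> = covers_of L \<one> ^ card P * ?d ^ (p * card P)"
    unfolding pw by (simp add: power_mult_distrib power_add)
  finally have "(\<Prod>x\<in>P. covers_of L x) ^ p * ?d ^ (p * card P) \<le> covers_of L \<one> ^ card P * ?d ^ (p * card P)" .
  then show ?thesis using d0 by (simp add: covers_bound_def)
qed

lemma covers_bound_carrier:
  assumes P: "P \<in> Syl"
  shows "covers_bound P (carrier G)"
proof -
  have "Q <#> carrier G = carrier G" if "Q \<in> Syl" for Q
  proof -
    have sQ: "subgroup Q G" using that by (simp add: sylow_iff)
    show ?thesis
      using set_mult_least[OF subgroup_self subgroup.subset[OF sQ] subset_refl] subset_set_mult(2)[OF subgroup_self sQ] by blast
  qed
  then have "cover (carrier G) = (\<lambda>Q. carrier G) ` Syl" unfolding cover_def by (intro image_cong refl)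
  then have cov: "cover (carrier G) = {carrier G}" using P by blast
  have "covers_of (carrier G) x = 1" if "x \<in> carrier G" for x
  proof -
    have "{T \<in> cover (carrier G). x \<in> T} = {carrier G}" using that unfolding cov by blast
    then show ?thesis by (simp add: covers_of_def)
  qed
  moreover have "P \<subseteq> carrier G" using P by (rule sylow_subset)
  ultimately show ?thesis by (simp add: covers_bound_def subset_iff)
qed

text \<open>Descent along the series, starting from \<open>G\<close>, which is its own only overgroup.\<close>
lemma covers_bound_if_p_solvable:
  assumes sol: "p_solvable p G" and P: "P \<in> Syl"
  shows "covers_bound P {\<one>}"
proof -
  obtain n :: nat and N where N: "N 0 = {\<one>}" "N n = carrier G" "\<And>i. i \<le> n \<Longrightarrow> N i \<lhd> G"
    "\<And>i. i < n \<Longrightarrow> N i \<subseteq> N (Suc i)"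
    "\<And>i. i < n \<Longrightarrow> (\<exists>k. Coset.order ((G\<lparr>carrier := N (Suc i)\<rparr>) Mod N i) = p ^ k) \<or>
            coprime p (Coset.order ((G\<lparr>carrier := N (Suc i)\<rparr>) Mod N i))"
    using sol unfolding p_solvable_def by metis
  have "covers_bound P (N (n - j))" if "j \<le> n" for j
    using that
  proof (induction j)
    case 0
    then show ?case using covers_bound_carrier[OF P] N(2) by simp
  next
    case (Suc j)
    define i where "i = n - Suc j"
    have i: "i < n" "n - j = Suc i" using Suc.prems by (auto simp: i_def)
    have L: "N i \<lhd> G" and K: "N (Suc i) \<lhd> G" using N(3) i by auto
    have LK: "N i \<subseteq> N (Suc i)" using N(4) i by blast
    have sL: "subgroup (N i) G" and sK: "subgroup (N (Suc i)) G" using L K normal_imp_subgroup by auto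
    interpret KG: group "G\<lparr>carrier := N (Suc i)\<rparr>" using sK by (rule subgroup_imp_group)
    let ?m = "Coset.order ((G\<lparr>carrier := N (Suc i)\<rparr>) Mod N i)"
    have c: "card (N (Suc i)) = card (N i) * ?m"
      using KG.lagrange[OF subgroup_incl[OF sL sK LK]] by (simp add: order_def FactGroup_def mult.commute)
    have IH: "covers_bound P (N (Suc i))" using Suc i by simp
    from N(5)[OF i(1)] have "covers_bound P (N i)"
    proof
      assume "\<exists>k. ?m = p ^ k"
      then obtain k where "?m = p ^ k" by blast
      then have "cover (N i) = cover (N (Suc i))" using p_factor_cover[OF L K LK] c by metis
      then show ?thesis using IH by (simp add: covers_bound_def covers_of_def)
    next
      assume "coprime p ?m"
      then show ?thesis using p'_factor_bound[OF L K LK c _ P IH] by blast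
    qed
    then show ?case by (simp add: i_def)
  qed
  from this[of n] show ?thesis using N(1) by simp
qed

end

section \<open>Counting the elements of prime power order\<close>

text \<open>The inequality of arithmetic and geometric means for the numbers \<open>1 / l x\<close>, obtained
  by summing the tangent estimate \<open>exp u \<ge> 1 + u\<close> at \<open>u = ln (t / l x)\<close>, where
  \<open>t = n\<^bsup>1/p\<^esup>\<close>.\<close>
lemma sum_inverse_ge_of_prod_le:
  fixes l :: "'b \<Rightarrow> nat" and n p :: nat
  assumes fin: "finite A" and ne: "A \<noteq> {}" and p: "p > 0" and n: "n > 0" and l: "\<And>x. x \<in> A \<Longrightarrow> l x > 0"
    and prod: "(\<Prod>x\<in>A. l x) ^ p \<le> n ^ card A"
  shows "(\<Sum>x\<in>A. 1 / real (l x)) \<ge> real (card A) * real n powr (- 1 / real p)"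
proof -
  define t where "t = real n powr (1 / real p)"
  have t: "t > 0" using n by (simp add: t_def)
  have lnt: "ln t = ln (real n) / real p" using n by (simp add: t_def ln_powr)
  have pr: "(\<Prod>x\<in>A. real (l x)) > 0" using l by (intro prod_pos) auto
  have "real p * (\<Sum>x\<in>A. ln (real (l x))) = ln ((\<Prod>x\<in>A. real (l x)) ^ p)"
    using l fin pr by (simp add: ln_realpow ln_prod)
  also have "\<dots> \<le> ln (real n ^ card A)"
  proof -
    have "real ((\<Prod>x\<in>A. l x) ^ p) \<le> real (n ^ card A)" using prod by (rule of_nat_mono)
    then show ?thesis using pr n by (simp add: ln_mono)
  qed
  also have "\<dots> = real p * (real (card A) * ln t)" using n p by (simp add: ln_realpow lnt)
  finally have ln_le: "(\<Sum>x\<in>A. ln (real (l x))) \<le> real (card A) * ln t" using p by simp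
  have "(1 / t) * (1 - (ln (real (l x)) - ln t)) \<le> 1 / real (l x)" if x: "x \<in> A" for x
  proof -
    have lx: "real (l x) > 0" using l[OF x] by simp
    have "1 - (ln (real (l x)) - ln t) \<le> exp (ln t - ln (real (l x)))"
      using exp_ge_add_one_self[of "ln t - ln (real (l x))"] by linarith
    also have "\<dots> = t / real (l x)" using lx t by (simp add: exp_diff)
    finally show ?thesis using t by (simp add: field_simps)
  qed
  then have "(\<Sum>x\<in>A. (1 / t) * (1 - (ln (real (l x)) - ln t))) \<le> (\<Sum>x\<in>A. 1 / real (l x))" by (rule sum_mono)
  moreover have "(\<Sum>x\<in>A. (1 / t) * (1 - (ln (real (l x)) - ln t)))
      = (1 / t) * (real (card A) - ((\<Sum>x\<in>A. ln (real (l x))) - real (card A) * ln t))"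
    by (simp add: sum_distrib_left[symmetric] sum_divide_distrib[symmetric] sum_subtractf sum.distrib)
  moreover have "(1 / t) * (real (card A) - ((\<Sum>x\<in>A. ln (real (l x))) - real (card A) * ln t)) \<ge> (1 / t) * real (card A)"
    using ln_le t by (intro mult_left_mono) auto
  moreover have "real n powr (- 1 / real p) = 1 / t" by (simp add: t_def powr_minus_divide)
  ultimately show ?thesis by (simp add: mult.commute)
qed

context finite_group_with_prime begin

lemma cover_one: "cover {\<one>} = Syl"
proof -
  have "Q <#> {\<one>} = Q" if "Q \<in> Syl" for Q
  proof -
    have sQ: "subgroup Q G" using that by (simp add: sylow_iff)
    show ?thesis
      using set_mult_least[OF sQ subset_refl, of "{\<one>}"] subset_set_mult(1)[OF triv_subgroup sQ]
        subgroup.one_closed[OF sQ] by blast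
  qed
  then show ?thesis by (simp add: cover_def)
qed

lemma p_elements_eq: "Syl \<noteq> {} \<Longrightarrow> p_elements p G = \<Union>Syl"
proof (intro equalityI subsetI)
  fix x assume ne: "Syl \<noteq> {}" and x: "x \<in> p_elements p G"
  then obtain k where k: "x \<in> carrier G" "ord x = p ^ k" by (auto simp: p_elements_def)
  obtain P where P: "P \<in> Syl" using ne by blast
  have "P \<subseteq> carrier G" using P by (rule sylow_subset)
  then obtain t where "t \<in> carrier G" "x \<in> conj_set G t P"
    using sylow_containing[OF P subgroup_self _ k] by blast
  then show "x \<in> \<Union>Syl" using conj_sylow[OF P] by blast
next
  fix x assume "x \<in> \<Union>Syl"
  then obtain Q where Q: "Q \<in> Syl" "x \<in> Q" by blast
  then have "x \<in> carrier G" using sylow_subset by blast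
  then show "x \<in> p_elements p G" using sylow_ord[OF Q] by (simp add: p_elements_def)
qed

lemma card_sylow_containing_conj:
  assumes x: "x \<in> carrier G" and g: "g \<in> carrier G"
  shows "card {Q \<in> Syl. g \<otimes> x \<otimes> inv g \<in> Q} = card {Q \<in> Syl. x \<in> Q}"
proof -
  have sG: "Q \<subseteq> carrier G" if "Q \<in> Syl" for Q using that by (rule sylow_subset)
  have "bij_betw (conj_set G g) {Q \<in> Syl. x \<in> Q} {Q \<in> Syl. g \<otimes> x \<otimes> inv g \<in> Q}"
  proof (rule bij_betwI[where g = "conj_set G (inv g)"])
    show "conj_set G g \<in> {Q \<in> Syl. x \<in> Q} \<rightarrow> {Q \<in> Syl. g \<otimes> x \<otimes> inv g \<in> Q}"
      using conj_sylow g by (auto simp: conj_set_def)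
    show "conj_set G (inv g) \<in> {Q \<in> Syl. g \<otimes> x \<otimes> inv g \<in> Q} \<rightarrow> {Q \<in> Syl. x \<in> Q}"
    proof
      fix Q assume Q: "Q \<in> {Q \<in> Syl. g \<otimes> x \<otimes> inv g \<in> Q}"
      then have "inv g \<otimes> (g \<otimes> x \<otimes> inv g) \<otimes> inv (inv g) \<in> conj_set G (inv g) Q"
        unfolding conj_set_def by (intro imageI) blast
      then have "x \<in> conj_set G (inv g) Q" using x g by (simp add: m_assoc inv_mult_cancel_left)
      then show "conj_set G (inv g) Q \<in> {Q \<in> Syl. x \<in> Q}" using Q conj_sylow g by simp
    qed
  next
    fix Q assume "Q \<in> {Q \<in> Syl. x \<in> Q}"
    then show "conj_set G (inv g) (conj_set G g Q) = Q" using conj_set_inv_cancel(1) g sG by blast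
  next
    fix Q assume "Q \<in> {Q \<in> Syl. g \<otimes> x \<otimes> inv g \<in> Q}"
    then show "conj_set G g (conj_set G (inv g) Q) = Q" using conj_set_inv_cancel(2) g sG by blast
  qed
  from bij_betw_same_card[OF this] show ?thesis by (rule sym)
qed

text \<open>Every \<open>p\<close>-element \<open>x\<close> lies in some Sylow subgroup; spread its weight
  \<open>1\<close> evenly over all that contain it. By conjugacy each Sylow subgroup receives the same total
  weight.\<close>
lemma card_p_elements:
  assumes P: "P \<in> Syl"
  shows "real (card (p_elements p G)) = real (card Syl) * (\<Sum>x\<in>P. 1 / real (card {Q \<in> Syl. x \<in> Q}))"
proof -
  let ?l = "\<lambda>x. real (card {Q \<in> Syl. x \<in> Q})" and ?U = "\<Union>Syl"
  have sG: "Q \<subseteq> carrier G" if "Q \<in> Syl" for Q using that by (rule sylow_subset)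
  have finU: "finite ?U" by (rule finite_subset[OF Union_least finite_G]) (rule sG)
  have pos: "?l x > 0" if "x \<in> ?U" for x
  proof -
    have "{Q \<in> Syl. x \<in> Q} \<noteq> {}" "finite {Q \<in> Syl. x \<in> Q}" using that finite_Syl by auto
    then show ?thesis unfolding of_nat_0_less_iff card_gt_0_iff by blast
  qed
  have inner: "(\<Sum>x\<in>Q. 1 / ?l x) = (\<Sum>x\<in>P. 1 / ?l x)" if Q: "Q \<in> Syl" for Q
  proof -
    obtain g where g: "g \<in> carrier G" "conj_set G g P = Q"
      using sylow_conj_in[OF Q subgroup_self sG[OF Q] P sG[OF P]] by blast
    have inj: "inj_on (\<lambda>s. g \<otimes> s \<otimes> inv g) P"
      by (rule inj_onI) (rule conj_inj[OF g(1) subsetD[OF sG[OF P]] subsetD[OF sG[OF P]]])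
    have "(\<Sum>x\<in>Q. 1 / ?l x) = (\<Sum>x\<in>P. 1 / ?l (g \<otimes> x \<otimes> inv g))"
      unfolding g(2)[symmetric] conj_set_def sum.reindex[OF inj] by (simp only: o_def)
    also have "\<dots> = (\<Sum>x\<in>P. 1 / ?l x)"
    proof (rule sum.cong[OF refl])
      fix x assume "x \<in> P"
      then have "x \<in> carrier G" using sG[OF P] by blast
      then show "1 / ?l (g \<otimes> x \<otimes> inv g) = 1 / ?l x" by (simp only: card_sylow_containing_conj[OF _ g(1)])
    qed
    finally show ?thesis .
  qed
  have "real (card ?U) = (\<Sum>x\<in>?U. ?l x * (1 / ?l x))" using pos by (simp add: less_imp_neq[symmetric])
  also have "\<dots> = (\<Sum>x\<in>?U. \<Sum>Q\<in>{Q \<in> Syl. x \<in> Q}. 1 / ?l x)" by simp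
  also have "\<dots> = (\<Sum>x\<in>?U. \<Sum>Q\<in>Syl. if x \<in> Q then 1 / ?l x else 0)"
    by (rule sum.cong[OF refl], rule sum.inter_filter[OF finite_Syl])
  also have "\<dots> = (\<Sum>Q\<in>Syl. \<Sum>x\<in>?U. if x \<in> Q then 1 / ?l x else 0)" by (rule sum.swap)
  also have "\<dots> = (\<Sum>Q\<in>Syl. \<Sum>x\<in>Q. 1 / ?l x)"
  proof (rule sum.cong[OF refl])
    fix Q assume "Q \<in> Syl"
    then have "{x \<in> ?U. x \<in> Q} = Q" by blast
    then show "(\<Sum>x\<in>?U. if x \<in> Q then 1 / ?l x else 0) = (\<Sum>x\<in>Q. 1 / ?l x)"
      using sum.inter_filter[OF finU, of "\<lambda>x. 1 / ?l x" "\<lambda>x. x \<in> Q"] by simp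
  qed
  also have "\<dots> = real (card Syl) * (\<Sum>x\<in>P. 1 / ?l x)" using inner by simp
  finally have "real (card ?U) = real (card Syl) * (\<Sum>x\<in>P. 1 / ?l x)" .
  moreover have "p_elements p G = ?U" by (rule p_elements_eq) (use P in blast)
  ultimately show ?thesis by (simp only:)
qed

end

theorem theorem1p1:
  fixes G :: "('a, 'b) monoid_scheme" and p :: nat and P :: "'a set"
  assumes "Factorial_Ring.prime p"
    and "Group.group G"
    and "finite (carrier G)"
    and "p_solvable p G"
    and "p dvd Coset.order G"
    and "P \<in> sylow_subgroups p G"
  shows "real (card (p_elements p G)) / real (card P)
           \<ge> real (card (sylow_subgroups p G)) powr ((real p - 1) / real p)"
proof -
  interpret finite_group_with_prime G p
    by (intro finite_group_with_prime.intro finite_group_with_prime_axioms.intro assms)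
  have P: "P \<in> Syl" by (rule assms(6))
  have sP: "subgroup P G" using P by (simp add: sylow_iff)
  let ?n = "card Syl" and ?l = "\<lambda>x. card {Q \<in> Syl. x \<in> Q}"
  have n0: "?n > 0" unfolding card_gt_0_iff using P finite_Syl by blast
  have p0: "p > 0" using prime_gt_0_nat[OF assms(1)] .
  have P0: "card P > 0" by (rule card_subgroup_pos[OF sP])
  have "\<one>\<^bsub>G\<^esub> \<in> Q" if "Q \<in> Syl" for Q using that subgroup.one_closed unfolding sylow_iff by blast
  then have "{Q \<in> Syl. \<one>\<^bsub>G\<^esub> \<in> Q} = Syl" by blast
  then have "(\<Prod>x\<in>P. ?l x) ^ p \<le> ?n ^ card P"
    using covers_bound_if_p_solvable[OF assms(4) P] by (simp add: covers_bound_def covers_of_def cover_one)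
  moreover have "?l x > 0" if "x \<in> P" for x
  proof -
    have "P \<in> {Q \<in> Syl. x \<in> Q}" "finite {Q \<in> Syl. x \<in> Q}" using that P finite_Syl by simp_all
    then show ?thesis unfolding card_gt_0_iff by blast
  qed
  moreover have "P \<noteq> {}" using P0 by auto
  ultimately have "(\<Sum>x\<in>P. 1 / real (?l x)) \<ge> real (card P) * real ?n powr (- 1 / real p)"
    by (intro sum_inverse_ge_of_prod_le[OF subgroup_finite[OF sP] _ p0 n0]) assumption+
  then have "real ?n * (real (card P) * real ?n powr (- 1 / real p)) \<le> real (card (p_elements p G))"
    unfolding card_p_elements[OF P] by (rule mult_left_mono) simp
  moreover have "real ?n * real ?n powr (- 1 / real p) = real ?n powr ((real p - 1) / real p)"
  proof -
    have "real ?n * real ?n powr (- 1 / real p) = real ?n powr 1 * real ?n powr (- 1 / real p)" using n0 by simp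
    also have "\<dots> = real ?n powr (1 + - 1 / real p)" by (rule powr_add[symmetric])
    also have "1 + - 1 / real p = (real p - 1) / real p" using p0 by (simp add: field_simps)
    finally show ?thesis .
  qed
  ultimately have "real (card P) * real ?n powr ((real p - 1) / real p) \<le> real (card (p_elements p G))"
    by (metis mult.left_commute)
  then show ?thesis using P0 by (simp add: field_simps)
qed
end
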